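(* Let $\lambda\vDash n$ be a composition of $n$. Then $|Y(\lambda)|=1$ if, and only if, either $\lambda$ or its reverse composition $\dot\lambda$ is a partition.
   Context: A composition $\lambda=(\lambda_1,\ldots,\lambda_r)$ of $n$ (written $\lambda\vDash n$) is a finite sequence of positive integers with sum $n$; it is a partition if $\lambda_1\ge\cdots\ge\lambda_r$. The reverse composition is $\dot\lambda=(\lambda_r,\ldots,\lambda_1)$. $S_n$ acts on the right on $\{1,\ldots,n\}$ (products are composed left to right), with Coxeter generators $S=\{s_1,\ldots,s_{n-1}\}$, $s_i=(i,i+1)$, and Coxeter length $l$. An element $x$ is a prefix of $y$ if $y$ has a reduced expression beginning with a reduced expression for $x$ (equivalently $l(y)=l(x)+l(x^{-1}y)$). For $\lambda\vDash n$ let $J(\lambda)=S\setminus\{s_{\lambda_1},s_{\lambda_1+\lambda_2},\ldots,s_{\lambda_1+\cdots+\lambda_{r-1}}\}$, let $W_{J(\lambda)}=\langle J(\lambda)\rangle$, let $w_{J(\lambda)}$ be the longest element of $W_{J(\lambda)}$, and let $\mathfrak{X}_{J(\lambda)}$ be the set of minimum length representatives of the right cosets $W_{J(\lambda)}w$. $\sim_R$ is the Kazhdan-Lusztig right cell equivalence on $S_n$; explicitly, $w\sim_R w'$ if and only if the Robinson-Schensted recording tableaux agree, $\mathcal Q(w)=\mathcal Q(w')$, where $w$ is inserted via its row-form $[1w,2w,\ldots,nw]$. $Z(\lambda)=\{e\in\mathfrak{X}_{J(\lambda)} : w_{J(\lambda)}e\sim_R w_{J(\lambda)}\}$, and the rim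 is $Y(\lambda)=\{x\in Z(\lambda) : x\text{ is not a prefix of any other }y\in Z(\lambda)\}$. *)

theory Defs
  imports "HOL-Algebra.Sym_Groups"
begin

text \<open>
  The elements of \<open>S\<^sub>n\<close> are the functions \<open>w :: nat \<Rightarrow> nat\<close> with \<open>w permutes {1..n}\<close>, and
  \<open>w i\<close> is the image written \<open>i w\<close> when \<open>S\<^sub>n\<close> acts on the right. Products are composed left to
  right, so they are opposite to the multiplication of \<^const>\<open>sym_group\<close>.
\<close>

definition rmult :: "(nat \<Rightarrow> nat) \<Rightarrow> (nat \<Rightarrow> nat) \<Rightarrow> nat \<Rightarrow> nat"  (infixl "\<odot>" 70)
  where "x \<odot> y = y \<circ> x"

definition coxeter_gen :: "nat \<Rightarrow> nat \<Rightarrow> nat"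
  where "coxeter_gen i = transpose i (Suc i)"

definition coxeter_gens :: "nat \<Rightarrow> (nat \<Rightarrow> nat) set"
  where "coxeter_gens n = coxeter_gen ` {i. 1 \<le> i \<and> i < n}"

definition word_prod :: "(nat \<Rightarrow> nat) list \<Rightarrow> nat \<Rightarrow> nat"
  where "word_prod ws = foldr (\<odot>) ws id"

definition is_expression :: "nat \<Rightarrow> (nat \<Rightarrow> nat) list \<Rightarrow> (nat \<Rightarrow> nat) \<Rightarrow> bool"
  where "is_expression n ws w \<longleftrightarrow> set ws \<subseteq> coxeter_gens n \<and> word_prod ws = w"

definition coxeter_length :: "nat \<Rightarrow> (nat \<Rightarrow> nat) \<Rightarrow> nat"
  where "coxeter_length n w = (LEAST k. \<exists>ws. is_expression n ws w \<and> length ws = k)"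

definition reduced_expression :: "nat \<Rightarrow> (nat \<Rightarrow> nat) list \<Rightarrow> (nat \<Rightarrow> nat) \<Rightarrow> bool"
  where "reduced_expression n ws w \<longleftrightarrow>
    is_expression n ws w \<and> length ws = coxeter_length n w"

definition is_prefix :: "nat \<Rightarrow> (nat \<Rightarrow> nat) \<Rightarrow> (nat \<Rightarrow> nat) \<Rightarrow> bool"
  where "is_prefix n x y \<longleftrightarrow>
    (\<exists>us vs. reduced_expression n us x \<and> reduced_expression n (us @ vs) y)"

definition composition :: "nat list \<Rightarrow> nat \<Rightarrow> bool"
  where "composition lam n \<longleftrightarrow> (\<forall>k\<in>set lam. 0 < k) \<and> sum_list lam = n"

definition is_partition :: "nat list \<Rightarrow> nat \<Rightarrow> bool"
  where "is_partition lam n \<longleftrightarrow> composition lam n \<and> sorted_wrt (\<ge>) lam"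

definition J_of :: "nat \<Rightarrow> nat list \<Rightarrow> (nat \<Rightarrow> nat) set"
  where "J_of n lam =
    coxeter_gens n - {coxeter_gen (sum_list (take i lam)) | i. 1 \<le> i \<and> i < length lam}"

definition parabolic :: "nat \<Rightarrow> (nat \<Rightarrow> nat) set \<Rightarrow> (nat \<Rightarrow> nat) set"
  where "parabolic n J = generate (sym_group n) J"

definition longest_elt :: "nat \<Rightarrow> (nat \<Rightarrow> nat) set \<Rightarrow> nat \<Rightarrow> nat"
  where "longest_elt n J =
    (THE w. w \<in> parabolic n J \<and> (\<forall>u\<in>parabolic n J. coxeter_length n u \<le> coxeter_length n w))"

definition min_coset_reps :: "nat \<Rightarrow> (nat \<Rightarrow> nat) set \<Rightarrow> (nat \<Rightarrow> nat) set"
  where "min_coset_reps n J =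
    {d \<in> carrier (sym_group n).
      \<forall>u\<in>parabolic n J. coxeter_length n d \<le> coxeter_length n (u \<odot> d)}"

text \<open>
  Robinson--Schensted row insertion. A tableau is the list of its rows, top row first.
  \<open>row_insert x row\<close> returns the new row and the entry bumped out of it, if any;
  \<open>tab_insert x P\<close> returns the new tableau and the index of the row that has grown.
\<close>

fun row_insert :: "nat \<Rightarrow> nat list \<Rightarrow> nat list \<times> nat option" where
  "row_insert x [] = ([x], None)"
| "row_insert x (y # ys) =
    (if x < y then (x # ys, Some y)
     else (case row_insert x ys of (zs, b) \<Rightarrow> (y # zs, b)))"

fun tab_insert :: "nat \<Rightarrow> nat list list \<Rightarrow> nat list list \<times> nat" where
  "tab_insert x [] = ([[x]], 0)"
| "tab_insert x (row # rows) =
    (case row_insert x row of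
       (row', None) \<Rightarrow> (row' # rows, 0)
     | (row', Some y) \<Rightarrow> (case tab_insert y rows of (rows', r) \<Rightarrow> (row' # rows', Suc r)))"

definition add_box :: "nat \<Rightarrow> nat \<Rightarrow> nat list list \<Rightarrow> nat list list"
  where "add_box k r Q = (if r < length Q then Q[r := Q ! r @ [k]] else Q @ [[k]])"

definition rs_step ::
  "nat \<Rightarrow> nat \<Rightarrow> nat list list \<times> nat list list \<Rightarrow> nat list list \<times> nat list list"
  where "rs_step k x PQ =
    (case PQ of (P, Q) \<Rightarrow> (case tab_insert x P of (P', r) \<Rightarrow> (P', add_box k r Q)))"

definition robinson_schensted ::
  "nat \<Rightarrow> (nat \<Rightarrow> nat) \<Rightarrow> nat list list \<times> nat list list"
  where "robinson_schensted n w = fold (\<lambda>k. rs_step k (w k)) [1..<Suc n] ([], [])"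

definition recording_tableau :: "nat \<Rightarrow> (nat \<Rightarrow> nat) \<Rightarrow> nat list list"
  where "recording_tableau n w = snd (robinson_schensted n w)"

text \<open>
  The Kazhdan--Lusztig right cell equivalence on \<open>S\<^sub>n\<close>, in its explicit description by recording
  tableaux. Under the right action, multiplication on the right permutes the values in
  the row-form of \<open>w\<close>, so right cells are the classes of constant recording tableau.
\<close>

definition right_cell_equiv :: "nat \<Rightarrow> (nat \<Rightarrow> nat) \<Rightarrow> (nat \<Rightarrow> nat) \<Rightarrow> bool"
  where "right_cell_equiv n w w' \<longleftrightarrow> recording_tableau n w = recording_tableau n w'"

definition Z_set :: "nat \<Rightarrow> nat list \<Rightarrow> (nat \<Rightarrow> nat) set"
  where "Z_set n lam =
    {e \<in> min_coset_reps n (J_of n lam).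
      right_cell_equiv n (longest_elt n (J_of n lam) \<odot> e) (longest_elt n (J_of n lam))}"

definition rim :: "nat \<Rightarrow> nat list \<Rightarrow> (nat \<Rightarrow> nat) set"
  where "rim n lam = {x \<in> Z_set n lam. \<not> (\<exists>y\<in>Z_set n lam. y \<noteq> x \<and> is_prefix n x y)}"

end

theory Submission
  imports Defs
begin

text \<open>
  An element \<open>e\<close> of \<open>Z(\<lambda>)\<close> increases on the blocks of positions given by \<open>\<lambda>\<close>, and the row form of
  \<open>w\<^sub>J e\<close> consists of descending blocks of lengths \<open>\<lambda>\<^sub>1, \<dots>, \<lambda>\<^sub>r\<close>. An increasing subsequence meets each
  block at most once, so \<open>m\<close> disjoint ones have at most \<open>\<Sum>\<^sub>k min(\<lambda>\<^sub>k, m)\<close> letters. By Greene's theorem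
  (\<open>has_chains_iff\<close>) the first \<open>m\<close> rows of the insertion tableau have at most that many boxes together.
  Equality for all \<open>m\<close> fixes the shape after each block, and hence the recording tableau, because the new
  boxes of a descending block appear in lower and lower rows; \<open>w\<^sub>J\<close> itself attains equality. Hence
  \<open>e \<in> Z(\<lambda>)\<close> iff for every \<open>m\<close> there are \<open>m\<close> disjoint chains, increasing from block to block, that
  meet the \<open>k\<close>-th block exactly \<open>min(\<lambda>\<^sub>k, m)\<close> times (\<open>Z_set_iff\<close>).

  The prefix order is the weak order, that is, inclusion of the sets of inverted pairs of positions
  (\<open>is_prefix_iff\<close>). Write \<open>(k, i)\<close> for the \<open>i\<close>-th position of the \<open>k\<close>-th block and think of the blocks as
  the columns of a diagram. Numbering the boxes row by row, with the columns either aligned at the top or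
  aligned at the bottom, gives two elements of \<open>Z(\<lambda>)\<close>, whose rows are the required chains.

  If \<open>\<lambda>\<close> is a partition, the chains force \<open>e(k, i) < e(l, i)\<close> for \<open>k < l\<close>, so the top aligned filling has
  every inversion that occurs in \<open>Z(\<lambda>)\<close>; it is the only element of the rim. If the reverse of \<open>\<lambda>\<close> is a
  partition, the same holds for the bottom aligned filling.

  If \<open>\<lambda>\<close> is not monotone, there are \<open>k\<^sub>1 < k\<^sub>2 < k\<^sub>3\<close> such that the \<open>k\<^sub>2\<close>-th part is larger than both of the
  other two, or smaller than both. If the rim had one element \<open>y\<close> only, \<open>y\<close> would have the inversions of
  both fillings, so that \<open>e(k, i) < e(l, j)\<close> with \<open>k < l\<close> is possible in \<open>e = y\<close> only for \<open>i \<le> j\<close> and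
  \<open>i + \<lambda>\<^sub>l \<le> j + \<lambda>\<^sub>k\<close>. For a suitable \<open>m\<close> no system of \<open>m\<close> chains through the three blocks obeys these
  inequalities (\<open>no_upper_bound\<close>).
\<close>

section \<open>Chains in words and Knuth moves\<close>

text \<open>
  A family of \<open>m\<close> disjoint chains (increasing subsequences) in a word is encoded as a colouring of its
  letters: the words considered are lists of pairs of a letter and its colour, the colours below \<open>m\<close> stand
  for the chains, and a letter of any other colour is on no chain. The relation \<open>chain_rel m p q\<close> says that
  \<open>p\<close> may stand somewhere to the left of \<open>q\<close>.
\<close>

definition chain_rel :: "nat \<Rightarrow> nat \<times> nat \<Rightarrow> nat \<times> nat \<Rightarrow> bool"
  where "chain_rel m p q \<longleftrightarrow> (snd p = snd q \<and> snd p < m \<longrightarrow> fst p < fst q)"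

text \<open>
  \<open>has_chains m s u\<close>: the word \<open>u\<close> has \<open>m\<close> disjoint chains with at least \<open>s\<close> letters in total.
\<close>

definition has_chains :: "nat \<Rightarrow> nat \<Rightarrow> nat list \<Rightarrow> bool"
  where "has_chains m s u \<longleftrightarrow>
    (\<exists>ps. map fst ps = u \<and> sorted_wrt (chain_rel m) ps \<and> s \<le> length (filter (\<lambda>p. snd p < m) ps))"

text \<open>
  Words that have the same families of chains in every context. Knuth equivalent words are of this kind,
  and this is all that is needed of Knuth equivalence.
\<close>

definition chain_equiv :: "nat list \<Rightarrow> nat list \<Rightarrow> bool"
  where "chain_equiv u v \<longleftrightarrow> (\<forall>p q m s. has_chains m s (p @ u @ q) \<longleftrightarrow> has_chains m s (p @ v @ q))"

lemma chain_equiv_refl: "chain_equiv u u"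
  by (simp add: chain_equiv_def)

lemma chain_equiv_trans [trans]: "chain_equiv u v \<Longrightarrow> chain_equiv v w \<Longrightarrow> chain_equiv u w"
  by (simp add: chain_equiv_def)

lemma chain_equiv_context: "chain_equiv u v \<Longrightarrow> chain_equiv (a @ u @ b) (a @ v @ b)"
  unfolding chain_equiv_def by (metis append.assoc)

lemma chain_equiv_Cons: "chain_equiv u v \<Longrightarrow> chain_equiv (a # u) (a # v)"
  using chain_equiv_context[of u v "[a]" "[]"] by simp

lemma chain_equiv_append: "chain_equiv u v \<Longrightarrow> chain_equiv (u @ b) (v @ b)"
  using chain_equiv_context[of u v "[]" b] by simp

text \<open>
  Exchanges the colours \<open>c\<close> and \<open>d\<close>.
\<close>

definition swap_colour :: "nat \<Rightarrow> nat \<Rightarrow> nat \<times> nat \<Rightarrow> nat \<times> nat"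
  where "swap_colour c d p = (fst p, Transposition.transpose c d (snd p))"

lemma swap_colour_simps [simp]:
  "fst (swap_colour c d p) = fst p"
  "snd (swap_colour c d p) = Transposition.transpose c d (snd p)"
  by (simp_all add: swap_colour_def)

lemma transpose_less_iff: "c < m \<Longrightarrow> d < m \<Longrightarrow> Transposition.transpose c d k < m \<longleftrightarrow> k < (m::nat)"
  by (auto simp: Transposition.transpose_def)

lemma length_filter_swap_colour:
  assumes "c < m" "d < m"
  shows "length (filter (\<lambda>p. snd p < m) (map (swap_colour c d) ps)) = length (filter (\<lambda>p. snd p < m) ps)"
  using assms by (induction ps) (auto simp: transpose_less_iff)

lemma sorted_swap_colour:
  assumes "c < m" "d < m" "sorted_wrt (chain_rel m) ps"
  shows "sorted_wrt (chain_rel m) (map (swap_colour c d) ps)"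
proof -
  have "chain_rel m (swap_colour c d p) (swap_colour c d q)" if "chain_rel m p q" for p q
    using that assms(1,2) inj_eq[OF inj_transpose[of c d]]
    by (simp add: chain_rel_def transpose_less_iff)
  then show ?thesis
    unfolding sorted_wrt_map by (rule sorted_wrt_mono_rel[OF _ assms(3)])
qed

lemma map_fst_eq_splitE:
  assumes "map fst ps = p @ [x, y, z] @ q"
  obtains A cx cy cz B where "ps = A @ [(x, cx), (y, cy), (z, cz)] @ B" "map fst A = p" "map fst B = q"
proof -
  from assms obtain A C where A: "ps = A @ C" "map fst A = p" "map fst C = [x, y, z] @ q"
    by (metis map_eq_append_conv)
  then obtain D B where "C = D @ B" "map fst D = [x, y, z]" "map fst B = q"
    by (metis map_eq_append_conv)
  then obtain cx cy cz where "D = [(x, cx), (y, cy), (z, cz)]"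
    by (auto simp: map_eq_Cons_conv)
  with A \<open>C = D @ B\<close> \<open>map fst B = q\<close> that show thesis by auto
qed

lemma sorted_wrt_middle3:
  "sorted_wrt R (A @ [p, q, r] @ B) \<longleftrightarrow>
    sorted_wrt R A \<and> sorted_wrt R B \<and> R p q \<and> R p r \<and> R q r \<and>
    (\<forall>a\<in>set A. R a p \<and> R a q \<and> R a r) \<and> (\<forall>b\<in>set B. R p b \<and> R q b \<and> R r b) \<and>
    (\<forall>a\<in>set A. \<forall>b\<in>set B. R a b)"
  by (auto simp: sorted_wrt_append)

lemma chain_rel_raise: "chain_rel m a (x, c) \<Longrightarrow> x < y \<Longrightarrow> chain_rel m a (y, c)"
  and chain_rel_lower: "chain_rel m (z, c) b \<Longrightarrow> y < z \<Longrightarrow> chain_rel m (y, c) b"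
  and chain_rel_uncoloured: "chain_rel m a (x, m)" "chain_rel m (x, m) b"
  by (auto simp: chain_rel_def)

lemma chain_rel_other: "c \<noteq> d \<Longrightarrow> chain_rel m (x, c) (y, d)"
  and chain_rel_same: "x < y \<Longrightarrow> chain_rel m (x, c) (y, c)"
  and chain_rel_descent: "y < x \<Longrightarrow> chain_rel m (x, c) (y, d) \<longleftrightarrow> c \<noteq> d \<or> m \<le> c"
  by (auto simp: chain_rel_def)

lemma chain_rel_swap_right:
  assumes "c < m" "d < m" "c \<noteq> d" "chain_rel m (z, c) b" "chain_rel m (y, d) b" "y < z"
  shows "v \<le> z \<Longrightarrow> chain_rel m (v, d) (swap_colour c d b)"
    and "v \<le> y \<Longrightarrow> chain_rel m (v, c) (swap_colour c d b)"
  using assms by (auto simp: chain_rel_def Transposition.transpose_def)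

lemma chain_rel_swap_across:
  assumes "c < m" "d < m" "c \<noteq> d" "chain_rel m (z, c) b" "chain_rel m (y, d) b"
    "chain_rel m a (x, c)" "chain_rel m a (y, d)" "x < y" "y < z" "chain_rel m a b"
  shows "chain_rel m a (swap_colour c d b)"
  using assms by (auto simp: chain_rel_def Transposition.transpose_def)

lemma has_chainsI:
  "sorted_wrt (chain_rel m) ps \<Longrightarrow> s \<le> length (filter (\<lambda>p. snd p < m) ps) \<Longrightarrow> map fst ps = u \<Longrightarrow>
    has_chains m s u"
  unfolding has_chains_def by blast

text \<open>
  Only the chain through both of the letters \<open>x < z\<close> that change places is affected by a Knuth move.
  The letter \<open>y\<close> between them in size is next to them. If \<open>y\<close> is on no chain, it replaces \<open>x\<close> or \<open>z\<close>;
  otherwise the two chains exchange their tails at this place.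
\<close>

lemma has_chains_knuth1:
  assumes "x < y" "y < z"
  shows "has_chains m s (p @ [y, x, z] @ q) \<longleftrightarrow> has_chains m s (p @ [y, z, x] @ q)"
proof
  assume "has_chains m s (p @ [y, x, z] @ q)"
  then obtain ps where ps: "map fst ps = p @ [y, x, z] @ q" "sorted_wrt (chain_rel m) ps"
      "s \<le> length (filter (\<lambda>p. snd p < m) ps)"
    unfolding has_chains_def by blast
  from ps(1) obtain A cy cx cz B where split: "ps = A @ [(y, cy), (x, cx), (z, cz)] @ B"
      "map fst A = p" "map fst B = q"
    by (rule map_fst_eq_splitE)
  note srt = ps(2)[unfolded split(1) sorted_wrt_middle3] 
  note cnt = ps(3)[unfolded split(1)]
  have less: "x < y" "y < z" "x < z" using assms by auto
  consider "cx \<noteq> cz \<or> m \<le> cx" | "cx = cz" "cx < m" "m \<le> cy" | "cx = cz" "cx < m" "cy < m"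
    by linarith
  then show "has_chains m s (p @ [y, z, x] @ q)"
  proof cases
    case 1
    then have "sorted_wrt (chain_rel m) (A @ [(y, cy), (z, cz), (x, cx)] @ B)"
      using srt chain_rel_descent[OF less(3)] unfolding sorted_wrt_middle3 by blast
    then show ?thesis
      by (rule has_chainsI) (use cnt split in \<open>simp_all split: if_splits\<close>)
  next
    case 2
    then have "sorted_wrt (chain_rel m) (A @ [(y, cx), (z, cx), (x, m)] @ B)"
      using srt less unfolding sorted_wrt_middle3
      by (intro conjI ballI)
         (blast intro: chain_rel_uncoloured chain_rel_same chain_rel_raise[where x = x]
            chain_rel_lower[where z = z])+
    then show ?thesis
      by (rule has_chainsI) (use cnt split 2 in \<open>simp_all split: if_splits\<close>)
  next
    case 3
    let ?B = "map (swap_colour cx cy) B"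
    have "cy \<noteq> cx" using srt less 3 by (auto simp: chain_rel_def)
    have "sorted_wrt (chain_rel m) ?B"
      using srt 3 by (intro sorted_swap_colour) auto
    moreover have "chain_rel m (v, cy) (swap_colour cx cy b)" if "b \<in> set B" "v \<le> z" for b v
      using srt 3 that \<open>cy \<noteq> cx\<close> less by (intro chain_rel_swap_right(1)[where y = y and z = z]) auto
    moreover have "chain_rel m (v, cx) (swap_colour cx cy b)" if "b \<in> set B" "v \<le> y" for b v
      using srt 3 that \<open>cy \<noteq> cx\<close> less by (intro chain_rel_swap_right(2)[where y = y and z = z]) auto
    moreover have "chain_rel m a (swap_colour cx cy b)" if "a \<in> set A" "b \<in> set B" for a b
      using srt 3 that \<open>cy \<noteq> cx\<close> less
      by (intro chain_rel_swap_across[where x = x and y = y and z = z]) auto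
    moreover have "chain_rel m a (y, cx)" "chain_rel m a (z, cy)" if "a \<in> set A" for a
      using srt 3 that less chain_rel_raise[of m a x cx y] chain_rel_raise[of m a y cy z] by auto
    ultimately have "sorted_wrt (chain_rel m) (A @ [(y, cy), (z, cy), (x, cx)] @ ?B)"
      using srt less 3 \<open>cy \<noteq> cx\<close> unfolding sorted_wrt_middle3
      by (simp add: chain_rel_same chain_rel_other del: swap_colour_simps)
    moreover have "length (filter (\<lambda>p. snd p < m) ?B) = length (filter (\<lambda>p. snd p < m) B)"
      using 3 by (intro length_filter_swap_colour)
    then have "s \<le> length (filter (\<lambda>p. snd p < m) (A @ [(y, cy), (z, cy), (x, cx)] @ ?B))"
      using cnt 3 by simp
    ultimately show ?thesis
      by (rule has_chainsI) (simp add: split comp_def)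
  qed
next
  assume "has_chains m s (p @ [y, z, x] @ q)"
  then obtain ps where ps: "map fst ps = p @ [y, z, x] @ q" "sorted_wrt (chain_rel m) ps"
      "s \<le> length (filter (\<lambda>p. snd p < m) ps)"
    unfolding has_chains_def by blast
  from ps(1) obtain A cy cz cx B where split: "ps = A @ [(y, cy), (z, cz), (x, cx)] @ B"
      "map fst A = p" "map fst B = q"
    by (rule map_fst_eq_splitE)
  have "sorted_wrt (chain_rel m) (A @ [(y, cy), (x, cx), (z, cz)] @ B)"
    using ps(2) assms unfolding split(1) sorted_wrt_middle3 by (auto simp: chain_rel_def)
  then show "has_chains m s (p @ [y, x, z] @ q)"
    by (rule has_chainsI) (use ps(3) split in \<open>simp_all split: if_splits\<close>)
qed

lemma has_chains_knuth2:
  assumes "x < y" "y < z"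
  shows "has_chains m s (p @ [x, z, y] @ q) \<longleftrightarrow> has_chains m s (p @ [z, x, y] @ q)"
proof
  assume "has_chains m s (p @ [x, z, y] @ q)"
  then obtain ps where ps: "map fst ps = p @ [x, z, y] @ q" "sorted_wrt (chain_rel m) ps"
      "s \<le> length (filter (\<lambda>p. snd p < m) ps)"
    unfolding has_chains_def by blast
  from ps(1) obtain A cx cz cy B where split: "ps = A @ [(x, cx), (z, cz), (y, cy)] @ B"
      "map fst A = p" "map fst B = q"
    by (rule map_fst_eq_splitE)
  note srt = ps(2)[unfolded split(1) sorted_wrt_middle3] 
  note cnt = ps(3)[unfolded split(1)]
  have less: "x < y" "y < z" "x < z" using assms by auto
  consider "cx \<noteq> cz \<or> m \<le> cx" | "cx = cz" "cx < m" "m \<le> cy" | "cx = cz" "cx < m" "cy < m"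
    by linarith
  then show "has_chains m s (p @ [z, x, y] @ q)"
  proof cases
    case 1
    then have "sorted_wrt (chain_rel m) (A @ [(z, cz), (x, cx), (y, cy)] @ B)"
      using srt chain_rel_descent[OF less(3)] unfolding sorted_wrt_middle3 by blast
    then show ?thesis
      by (rule has_chainsI) (use cnt split in \<open>simp_all split: if_splits\<close>)
  next
    case 2
    then have "sorted_wrt (chain_rel m) (A @ [(z, m), (x, cx), (y, cx)] @ B)"
      using srt less unfolding sorted_wrt_middle3
      by (intro conjI ballI)
         (blast intro: chain_rel_uncoloured chain_rel_same chain_rel_raise[where x = x]
            chain_rel_lower[where z = z])+
    then show ?thesis
      by (rule has_chainsI) (use cnt split 2 in \<open>simp_all split: if_splits\<close>)
  next
    case 3
    let ?B = "map (swap_colour cx cy) B"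
    have "cy \<noteq> cx" using srt less 3 by (auto simp: chain_rel_def)
    have "sorted_wrt (chain_rel m) ?B"
      using srt 3 by (intro sorted_swap_colour) auto
    moreover have "chain_rel m (v, cy) (swap_colour cx cy b)" if "b \<in> set B" "v \<le> z" for b v
      using srt 3 that \<open>cy \<noteq> cx\<close> less by (intro chain_rel_swap_right(1)[where y = y and z = z]) auto
    moreover have "chain_rel m (v, cx) (swap_colour cx cy b)" if "b \<in> set B" "v \<le> y" for b v
      using srt 3 that \<open>cy \<noteq> cx\<close> less by (intro chain_rel_swap_right(2)[where y = y and z = z]) auto
    moreover have "chain_rel m a (swap_colour cx cy b)" if "a \<in> set A" "b \<in> set B" for a b
      using srt 3 that \<open>cy \<noteq> cx\<close> less
      by (intro chain_rel_swap_across[where x = x and y = y and z = z]) auto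
    moreover have "chain_rel m a (y, cx)" "chain_rel m a (z, cy)" if "a \<in> set A" for a
      using srt 3 that less chain_rel_raise[of m a x cx y] chain_rel_raise[of m a y cy z] by auto
    ultimately have "sorted_wrt (chain_rel m) (A @ [(z, cy), (x, cx), (y, cx)] @ ?B)"
      using srt less 3 \<open>cy \<noteq> cx\<close> unfolding sorted_wrt_middle3
      by (simp add: chain_rel_same chain_rel_other del: swap_colour_simps)
    moreover have "length (filter (\<lambda>p. snd p < m) ?B) = length (filter (\<lambda>p. snd p < m) B)"
      using 3 by (intro length_filter_swap_colour)
    then have "s \<le> length (filter (\<lambda>p. snd p < m) (A @ [(z, cy), (x, cx), (y, cx)] @ ?B))"
      using cnt 3 by simp
    ultimately show ?thesis
      by (rule has_chainsI) (simp add: split comp_def)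
  qed
next
  assume "has_chains m s (p @ [z, x, y] @ q)"
  then obtain ps where ps: "map fst ps = p @ [z, x, y] @ q" "sorted_wrt (chain_rel m) ps"
      "s \<le> length (filter (\<lambda>p. snd p < m) ps)"
    unfolding has_chains_def by blast
  from ps(1) obtain A cz cx cy B where split: "ps = A @ [(z, cz), (x, cx), (y, cy)] @ B"
      "map fst A = p" "map fst B = q"
    by (rule map_fst_eq_splitE)
  have "sorted_wrt (chain_rel m) (A @ [(x, cx), (z, cz), (y, cy)] @ B)"
    using ps(2) assms unfolding split(1) sorted_wrt_middle3 by (auto simp: chain_rel_def)
  then show "has_chains m s (p @ [x, z, y] @ q)"
    by (rule has_chainsI) (use ps(3) split in \<open>simp_all split: if_splits\<close>)
qed

lemma chain_equiv_knuth1: "x < y \<Longrightarrow> y < z \<Longrightarrow> chain_equiv [y, x, z] [y, z, x]"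
  and chain_equiv_knuth2: "x < y \<Longrightarrow> y < z \<Longrightarrow> chain_equiv [x, z, y] [z, x, y]"
  unfolding chain_equiv_def by (intro allI has_chains_knuth1 has_chains_knuth2; assumption)+

lemma chain_equiv_sym: "chain_equiv u v \<Longrightarrow> chain_equiv v u"
  by (simp add: chain_equiv_def)

section \<open>Row insertion\<close>

lemma row_insert_None: "row_insert x r = (r', None) \<Longrightarrow> r' = r @ [x] \<and> (\<forall>y\<in>set r. y \<le> x)"
  by (induction r arbitrary: r') (auto split: if_splits prod.splits)

lemma row_insert_Some_mset:
  "row_insert x r = (r', Some b) \<Longrightarrow> add_mset b (mset r') = add_mset x (mset r)"
  by (induction r arbitrary: r') (auto split: if_splits prod.splits)

lemma row_insert_Some_set:
  assumes "row_insert x r = (r', Some b)"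
  shows "insert b (set r') = insert x (set r)" "length r' = length r"
  using arg_cong[OF row_insert_Some_mset[OF assms], of set_mset]
    arg_cong[OF row_insert_Some_mset[OF assms], of size] by simp_all

lemma row_insert_Some_less: "row_insert x r = (r', Some b) \<Longrightarrow> x < b \<and> x \<in> set r' \<and> b \<in> set r"
  by (induction r arbitrary: r') (auto split: if_splits prod.splits)

lemma row_insert_Some_hd:
  "row_insert x r = (r', Some b) \<Longrightarrow> sorted_wrt (<) r \<Longrightarrow>
    \<exists>h t. r' = h # t \<and> h < b \<and> (h = x \<or> (\<exists>t'. r = h # t'))"
  by (cases r) (auto split: if_splits prod.splits dest: row_insert_Some_less)

lemma row_insert_sorted:
  "sorted_wrt (<) r \<Longrightarrow> x \<notin> set r \<Longrightarrow> row_insert x r = (r', b) \<Longrightarrow> sorted_wrt (<) r'"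
proof (induction r arbitrary: r')
  case (Cons y ys)
  show ?case
  proof (cases "x < y")
    case True
    with Cons.prems show ?thesis by fastforce
  next
    case False
    with Cons.prems obtain zs where zs: "row_insert x ys = (zs, b)" "r' = y # zs"
      by (auto split: prod.splits)
    have "set zs \<subseteq> insert x (set ys)"
    proof (cases b)
      case None
      with zs row_insert_None show ?thesis by fastforce
    next
      case (Some c)
      with zs row_insert_Some_set(1)[of x ys zs c] show ?thesis by auto
    qed
    moreover have "y < x" using False Cons.prems by auto
    ultimately show ?thesis using Cons zs by auto
  qed
qed simp

text \<open>
  A letter smaller than a whole row is carried to the place after the first letter of the row.
\<close>

lemma chain_equiv_pass_left:
  "sorted_wrt (<) (y # ys) \<Longrightarrow> x < y \<Longrightarrow> chain_equiv (y # ys @ [x]) (y # x # ys)"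
proof (induction ys arbitrary: y)
  case Nil
  show ?case by (simp add: chain_equiv_refl)
next
  case (Cons z zs)
  have "chain_equiv (y # z # zs @ [x]) (y # z # x # zs)"
    using Cons by (intro chain_equiv_Cons Cons.IH) auto
  also have "chain_equiv (y # z # x # zs) (y # x # z # zs)"
    using chain_equiv_append[OF chain_equiv_sym[OF chain_equiv_knuth1[of x y z]], of zs] Cons.prems
    by simp
  finally show ?case by simp
qed

text \<open>Row insertion is a sequence of Knuth moves that carries the bumped letter to the front of the row.\<close>

lemma chain_equiv_row_insert:
  "sorted_wrt (<) r \<Longrightarrow> x \<notin> set r \<Longrightarrow> row_insert x r = (r', Some b) \<Longrightarrow>
    chain_equiv (r @ [x]) (b # r')"
proof (induction r arbitrary: r')
  case (Cons y ys)
  show ?case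
  proof (cases "x < y")
    case True
    with Cons.prems chain_equiv_pass_left[of y ys x] show ?thesis by auto
  next
    case False
    with Cons.prems obtain zs where zs: "row_insert x ys = (zs, Some b)" "r' = y # zs"
      by (auto split: prod.splits)
    obtain h t where h: "zs = h # t" "h < b" "h = x \<or> (\<exists>t'. ys = h # t')"
      using row_insert_Some_hd[OF zs(1)] Cons.prems by auto
    have "y < h" using h(3) False Cons.prems by auto
    have "chain_equiv (y # ys @ [x]) (y # b # zs)"
      using Cons zs by (intro chain_equiv_Cons Cons.IH) auto
    also have "chain_equiv (y # b # zs) (b # y # zs)"
      using chain_equiv_append[OF chain_equiv_knuth2[OF \<open>y < h\<close> \<open>h < b\<close>], of t] h by simp
    finally show ?thesis using zs by simp
  qed
qed simp

text \<open>
  Row \<open>s\<close> fits below row \<open>r\<close>: it is not longer, and the columns increase downwards.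
\<close>

fun column_strict :: "nat list \<Rightarrow> nat list \<Rightarrow> bool" where
  "column_strict r [] \<longleftrightarrow> True"
| "column_strict [] (y # ys) \<longleftrightarrow> False"
| "column_strict (x # xs) (y # ys) \<longleftrightarrow> x < y \<and> column_strict xs ys"

lemma column_strict_iff:
  "column_strict r s \<longleftrightarrow> length s \<le> length r \<and> (\<forall>j<length s. r ! j < s ! j)"
proof (induction r s rule: column_strict.induct)
  case (3 x xs y ys)
  show ?case by (auto simp: 3 less_Suc_eq_0_disj nth_Cons split: nat.splits)
qed auto

lemma column_strict_trans: "column_strict r s \<Longrightarrow> column_strict s t \<Longrightarrow> column_strict r t"
  unfolding column_strict_iff by (meson dual_order.trans order_less_le_trans order_less_trans)

text \<open>
  A letter bumped from a row enters the next row in the same column or further to the left, which keeps the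
  columns increasing.
\<close>

lemma column_strict_row_insert_below:
  "sorted_wrt (<) r \<Longrightarrow> column_strict r s \<Longrightarrow> row_insert x r = (r', Some b) \<Longrightarrow>
    column_strict r' s \<and> column_strict r' (fst (row_insert b s))"
proof (induction r s arbitrary: r' rule: column_strict.induct)
  case (1 r)
  then show ?case
    using row_insert_Some_hd[of x r r' b] by auto
next
  case (3 y ys z zs)
  show ?case
  proof (cases "x < y")
    case True
    with 3 show ?thesis by auto
  next
    case False
    with "3.prems" obtain ws where ws: "row_insert x ys = (ws, Some b)" "r' = y # ws"
      by (auto split: prod.splits)
    have "y < b" using row_insert_Some_less[OF ws(1)] False by auto
    show ?thesis
      using 3 ws \<open>y < b\<close> by (auto split: prod.splits)
  qed
qed auto

text \<open>
  Tableaux with increasing rows and columns; the entries need not be \<open>1, \<dots>, n\<close>.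
\<close>

fun standard_tableau :: "nat list list \<Rightarrow> bool" where
  "standard_tableau [] \<longleftrightarrow> True"
| "standard_tableau [r] \<longleftrightarrow> sorted_wrt (<) r"
| "standard_tableau (r # s # P) \<longleftrightarrow> sorted_wrt (<) r \<and> column_strict r s \<and> standard_tableau (s # P)"

lemma standard_tableau_Cons:
  "standard_tableau (r # P) \<longleftrightarrow>
    sorted_wrt (<) r \<and> (P = [] \<or> column_strict r (hd P)) \<and> standard_tableau P"
  by (cases P) auto

lemma standard_tableau_iff:
  "standard_tableau P \<longleftrightarrow> (\<forall>r\<in>set P. sorted_wrt (<) r) \<and> sorted_wrt column_strict P"
proof (induction P rule: standard_tableau.induct)
  case (3 r s P)
  then show ?case
    by (auto intro: column_strict_trans)
qed auto

lemma tab_insert_hd: "tab_insert x P = (P', k) \<Longrightarrow> P' \<noteq> [] \<and> hd P' = fst (row_insert x (if P = [] then [] else hd P))"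
  by (cases P) (auto split: prod.splits option.splits)

lemma tab_insert_mset: "tab_insert x P = (P', k) \<Longrightarrow> mset (concat P') = add_mset x (mset (concat P))"
proof (induction x P arbitrary: P' k rule: tab_insert.induct)
  case (2 x row rows)
  obtain row' b where r: "row_insert x row = (row', b)" by fastforce
  show ?case
  proof (cases b)
    case None
    with 2 r row_insert_None[of x row row'] show ?thesis by auto
  next
    case (Some y)
    obtain rows' j where t: "tab_insert y rows = (rows', j)" by fastforce
    have "mset (concat rows') = add_mset y (mset (concat rows))"
      using 2 r Some t by auto
    with 2 r Some t row_insert_Some_mset[of x row row' y] show ?thesis
      by auto
  qed
qed auto

text \<open>Insertion keeps tableaux standard, and is a sequence of Knuth moves on the row reading word.\<close>

lemma tab_insert_standard:
  "standard_tableau P \<Longrightarrow> distinct (x # concat P) \<Longrightarrow> tab_insert x P = (P', k) \<Longrightarrow>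
    standard_tableau P' \<and> chain_equiv (concat (rev P) @ [x]) (concat (rev P'))"
proof (induction x P arbitrary: P' k rule: tab_insert.induct)
  case (1 x)
  then show ?case by (auto simp: chain_equiv_refl)
next
  case (2 x row rows)
  obtain row' b where r: "row_insert x row = (row', b)" by fastforce
  have row: "sorted_wrt (<) row" "x \<notin> set row" "standard_tableau rows"
    using 2 by (auto simp: standard_tableau_Cons)
  have row': "sorted_wrt (<) row'"
    using row_insert_sorted row r by blast
  show ?case
  proof (cases b)
    case None
    then have P': "P' = row' # rows" "row' = row @ [x]"
      using 2 r row_insert_None[of x row row'] by auto
    have "rows = [] \<or> column_strict row' (hd rows)"
      using "2.prems"(1) P'(2) by (auto simp: standard_tableau_Cons column_strict_iff nth_append)
    with row' row P' show ?thesis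
      by (simp add: standard_tableau_Cons chain_equiv_refl)
  next
    case (Some y)
    note r = r[unfolded Some]
    obtain rows' j where t: "tab_insert y rows = (rows', j)" by fastforce
    have "distinct (y # concat rows)"
      using 2 row_insert_Some_less[OF r] by auto
    then have IH: "standard_tableau rows'" "chain_equiv (concat (rev rows) @ [y]) (concat (rev rows'))"
      using 2 r t row by fastforce+
    have "column_strict row' (hd rows')"
      using "2.prems"(1) tab_insert_hd[OF t] column_strict_row_insert_below[OF row(1) _ r]
        column_strict_row_insert_below[OF row(1) _ r, of "[]"]
      by (cases rows) (auto simp: standard_tableau_Cons)
    with IH row' have "standard_tableau (row' # rows')"
      by (simp add: standard_tableau_Cons)
    moreover have "chain_equiv (concat (rev rows) @ row @ [x]) (concat (rev rows) @ (y # row'))"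
      using chain_equiv_context[OF chain_equiv_row_insert[OF row(1,2) r], of "concat (rev rows)" "[]"] by simp
    moreover have "chain_equiv (concat (rev rows) @ (y # row')) (concat (rev rows') @ row')"
      using chain_equiv_append[OF IH(2), of row'] by simp
    ultimately show ?thesis
      using "2.prems"(3) r t by (auto intro: chain_equiv_trans)
  qed
qed

text \<open>
  The insertion tableau \<open>insert_word P u\<close> obtained by inserting the letters of \<open>u\<close> into \<open>P\<close>, and the list
  \<open>growth_rows P u\<close> of the rows in which the successive new boxes appear. The latter determines the
  recording tableau.
\<close>

fun insert_word :: "nat list list \<Rightarrow> nat list \<Rightarrow> nat list list" where
  "insert_word P [] = P"
| "insert_word P (x # xs) = insert_word (fst (tab_insert x P)) xs"

fun growth_rows :: "nat list list \<Rightarrow> nat list \<Rightarrow> nat list" where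
  "growth_rows P [] = []"
| "growth_rows P (x # xs) = snd (tab_insert x P) # growth_rows (fst (tab_insert x P)) xs"

lemma insert_word_append: "insert_word P (u @ v) = insert_word (insert_word P u) v"
  by (induction P u rule: insert_word.induct) auto

lemma growth_rows_append: "growth_rows P (u @ v) = growth_rows P u @ growth_rows (insert_word P u) v"
  by (induction P u rule: insert_word.induct) auto

lemma length_growth_rows [simp]: "length (growth_rows P u) = length u"
  by (induction P u rule: insert_word.induct) auto

lemma insert_word_standard:
  "standard_tableau P \<Longrightarrow> distinct (concat P @ u) \<Longrightarrow>
    standard_tableau (insert_word P u) \<and> distinct (concat (insert_word P u)) \<and>
    chain_equiv (concat (rev P) @ u) (concat (rev (insert_word P u)))"
proof (induction P u rule: insert_word.induct)
  case (1 P)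
  then show ?case by (simp add: chain_equiv_refl)
next
  case (2 P x xs)
  obtain P' k where t: "tab_insert x P = (P', k)" by fastforce
  have d: "distinct (x # concat P)" using 2 by auto
  note st = tab_insert_standard[OF 2(2) d t]
  have m: "mset (concat P' @ xs) = mset (concat P @ x # xs)"
    using tab_insert_mset[OF t] by simp
  have "distinct (concat P' @ xs)"
    using mset_eq_imp_distinct_iff[OF m] 2 by blast
  then have IH: "standard_tableau (insert_word P' xs)" "distinct (concat (insert_word P' xs))"
      "chain_equiv (concat (rev P') @ xs) (concat (rev (insert_word P' xs)))"
    using 2 st t by auto
  moreover have "chain_equiv (concat (rev P) @ x # xs) (concat (rev P') @ xs)"
    using chain_equiv_append[of _ _ xs] st by fastforce
  ultimately show ?case using t by (auto intro: chain_equiv_trans)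
qed

section \<open>Greene's theorem\<close>

text \<open>
  Row lengths as a total function; missing rows have length \<open>0\<close>.
\<close>

definition row_length :: "nat list list \<Rightarrow> nat \<Rightarrow> nat"
  where "row_length P i = (if i < length P then length (P ! i) else 0)"

lemma row_length_simps [simp]:
  "row_length [] i = 0" "row_length (r # P) 0 = length r" "row_length (r # P) (Suc i) = row_length P i"
  by (simp_all add: row_length_def)

lemma tab_insert_shape:
  "tab_insert x P = (P', k) \<Longrightarrow>
    k \<le> length P \<and> length P' = (if k < length P then length P else Suc (length P)) \<and>
    (\<forall>i. row_length P' i = row_length P i + (if i = k then 1 else 0))"
proof (induction x P arbitrary: P' k rule: tab_insert.induct)
  case (1 x)
  then show ?case by (auto simp: row_length_def)
next
  case (2 x row rows)
  obtain row' b where r: "row_insert x row = (row', b)" by fastforce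
  show ?case
  proof (cases b)
    case None
    then have "P' = (row @ [x]) # rows" "k = 0"
      using 2 r row_insert_None[of x row row'] by auto
    then show ?thesis by (auto simp: row_length_def nth_Cons split: nat.splits)
  next
    case (Some y)
    obtain rows' j where t: "tab_insert y rows = (rows', j)" by fastforce
    have P': "P' = row' # rows'" "k = Suc j"
      using 2 r t Some by auto
    have IH: "j \<le> length rows" "length rows' = (if j < length rows then length rows else Suc (length rows))"
       "\<forall>i. row_length rows' i = row_length rows i + (if i = j then 1 else 0)"
      using "2.IH"[OF r[symmetric] Some t] by blast+
    have "length row' = length row"
      using row_insert_Some_set r Some by blast
    then have "row_length P' i = row_length (row # rows) i + (if i = k then 1 else 0)" for i
      using IH(3) P' by (cases i) auto
    then show ?thesis using P' IH by auto
  qed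
qed

lemma row_length_insert_word:
  "row_length (insert_word P u) i = row_length P i + count_list (growth_rows P u) i"
proof (induction P u rule: insert_word.induct)
  case (2 P x xs)
  then show ?case
    using tab_insert_shape[of x P "fst (tab_insert x P)" "snd (tab_insert x P)"] by auto
qed simp

lemma robinson_schensted_fold:
  "fold (\<lambda>k. rs_step k (w k)) ks (P, Q) =
    (insert_word P (map w ks),
     fold (\<lambda>(k, r). add_box k r) (zip ks (growth_rows P (map w ks))) Q)"
  by (induction ks arbitrary: P Q) (auto simp: rs_step_def split: prod.splits)

lemma recording_tableau_eq:
  "recording_tableau n w =
    fold (\<lambda>(k, r). add_box k r) (zip [1..<Suc n] (growth_rows [] (map w [1..<Suc n]))) []"
  unfolding recording_tableau_def robinson_schensted_def robinson_schensted_fold by simp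

lemma row_length_recording_fold:
  "length Q = length P \<Longrightarrow> row_length Q = row_length P \<Longrightarrow> length ks = length u \<Longrightarrow>
    row_length (fold (\<lambda>(k, r). add_box k r) (zip ks (growth_rows P u)) Q) = row_length (insert_word P u)"
proof (induction P u arbitrary: Q ks rule: insert_word.induct)
  case (2 P x xs)
  then obtain k ks' where ks: "ks = k # ks'" by (cases ks) auto
  obtain P' r where t: "tab_insert x P = (P', r)" by fastforce
  note sh = tab_insert_shape[OF t]
  have "length (add_box k r Q) = length P'"
    using sh 2 by (auto simp: add_box_def)
  moreover have "row_length (add_box k r Q) = row_length P'"
  proof
    fix i
    have "row_length (add_box k r Q) i = row_length Q i + (if i = r then 1 else 0)"
      using sh 2 by (auto simp: add_box_def row_length_def nth_list_update nth_append)
    then show "row_length (add_box k r Q) i = row_length P' i"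
      using sh 2 by simp
  qed
  ultimately show ?case using 2 t ks by simp
qed simp

lemma row_length_recording_tableau:
  "row_length (recording_tableau n w) = row_length (insert_word [] (map w [1..<Suc n]))"
  unfolding recording_tableau_eq by (rule row_length_recording_fold) auto

text \<open>
  After \<open>x\<close>, a smaller letter always bumps something, and bumps a smaller letter than \<open>x\<close> did.
\<close>

lemma row_insert_descent:
  "row_insert x r = (r', b) \<Longrightarrow> x' < x \<Longrightarrow> row_insert x' r' = (r'', b') \<Longrightarrow>
    \<exists>c. b' = Some c \<and> (\<forall>d. b = Some d \<longrightarrow> c < d)"
proof (induction r arbitrary: r' r'')
  case (Cons y ys)
  show ?case
  proof (cases "x < y")
    case True
    with Cons.prems show ?thesis by auto
  next
    case False
    with Cons.prems obtain zs where zs: "row_insert x ys = (zs, b)" "r' = y # zs"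
      by (auto split: prod.splits)
    show ?thesis
    proof (cases "x' < y")
      case True
      with Cons.prems zs False row_insert_Some_less[of x ys zs] show ?thesis
        by (cases b) (auto dest: order_le_less_trans)
    next
      case F: False
      with Cons.prems zs obtain zs' where "row_insert x' zs = (zs', b')"
        by (auto split: prod.splits)
      with Cons zs show ?thesis by blast
    qed
  qed
qed auto

lemma tab_insert_descent:
  "tab_insert x P = (P', k) \<Longrightarrow> x' < x \<Longrightarrow> tab_insert x' P' = (P'', k') \<Longrightarrow> k < k'"
proof (induction x P arbitrary: x' P' k P'' k' rule: tab_insert.induct)
  case (2 x row rows)
  obtain row' b where r: "row_insert x row = (row', b)" by fastforce
  obtain row'' b' where r': "row_insert x' row' = (row'', b')" by fastforce
  obtain c where c: "b' = Some c" "\<forall>d. b = Some d \<longrightarrow> c < d"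
    using row_insert_descent[OF r _ r'] 2 by auto
  show ?case
  proof (cases b)
    case None
    with "2.prems" r r' show ?thesis unfolding c(1) by (auto split: prod.splits)
  next
    case (Some d)
    obtain rows' j where t: "tab_insert d rows = (rows', j)" by fastforce
    obtain rows'' j' where t': "tab_insert c rows' = (rows'', j')" by fastforce
    have "j < j'" using "2.IH"[OF r[symmetric] Some t _ t'] c(2) Some by blast
    then show ?thesis using "2.prems" r r' Some t t' unfolding c(1) by auto
  qed
qed auto

text \<open>A descending word adds its boxes in lower and lower rows.\<close>

lemma growth_rows_descending:
  "sorted_wrt (>) u \<Longrightarrow> sorted_wrt (<) (growth_rows P u)"
proof (induction P u rule: insert_word.induct)
  case (2 P x xs)
  show ?case
  proof (cases xs)
    case (Cons x' xs')
    have "snd (tab_insert x P) < snd (tab_insert x' (fst (tab_insert x P)))"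
      using tab_insert_descent[of x P "fst (tab_insert x P)" "snd (tab_insert x P)" x'] 2 Cons
      by (metis list.set_intros(1) prod.collapse sorted_wrt.simps(2))
    with 2 Cons show ?thesis by (auto intro: less_trans)
  qed simp
qed simp

lemma sorted_wrt_concat:
  "sorted_wrt R (concat xss) \<longleftrightarrow>
    (\<forall>xs\<in>set xss. sorted_wrt R xs) \<and>
    sorted_wrt (\<lambda>xs ys. \<forall>x\<in>set xs. \<forall>y\<in>set ys. R x y) xss"
  by (induction xss) (auto simp: sorted_wrt_append)

lemma map_eq_concat_splitE:
  assumes "map f ps = concat xss"
  obtains yss where "ps = concat yss" "map (map f) yss = xss"
proof -
  have "\<exists>yss. ps = concat yss \<and> map (map f) yss = xss"
    using assms
  proof (induction xss arbitrary: ps)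
    case (Cons xs xss)
    then obtain qs rs where "ps = qs @ rs" "map f qs = xs" "map f rs = concat xss"
      by (metis concat.simps(2) map_eq_append_conv)
    with Cons.IH[of rs] obtain yss where "rs = concat yss" "map (map f) yss = xss" by blast
    then show ?case
      using \<open>ps = qs @ rs\<close> \<open>map f qs = xs\<close> by (intro exI[of _ "qs # yss"]) auto
  qed simp
  with that show thesis by blast
qed

text \<open>
  The two halves of Greene's theorem for the row reading word of a standard tableau: the first \<open>m\<close> rows are \<open>m\<close> disjoint
  chains, and no family of \<open>m\<close> chains does better, since it meets each column at most \<open>m\<close> times.
\<close>

lemma reading_word_has_chains:
  assumes "\<forall>r\<in>set P. sorted_wrt (<) r"
  shows "has_chains m (\<Sum>i<m. row_length P i) (concat (rev P))"
proof -
  have "\<exists>ps. map fst ps = concat (rev P) \<and> sorted_wrt (chain_rel m) ps \<and> (\<forall>p\<in>set ps. k \<le> snd p) \<and>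
      (\<Sum>i<m-k. row_length P i) \<le> length (filter (\<lambda>p. snd p < m) ps)" for k
    using assms
  proof (induction P arbitrary: k)
    case (Cons r P)
    then obtain ps where ps: "map fst ps = concat (rev P)" "sorted_wrt (chain_rel m) ps"
        "\<forall>p\<in>set ps. Suc k \<le> snd p" "(\<Sum>i<m-Suc k. row_length P i) \<le> length (filter (\<lambda>p. snd p < m) ps)"
      by (metis list.set_intros(2))
    let ?r = "map (\<lambda>a. (a, k)) r"
    have "sorted_wrt (chain_rel m) ?r"
      unfolding sorted_wrt_map
      by (rule sorted_wrt_mono_rel[of r "(<)"]) (use Cons in \<open>auto simp: chain_rel_def\<close>)
    then have "sorted_wrt (chain_rel m) (ps @ ?r)"
      using ps by (auto simp: sorted_wrt_append chain_rel_def Suc_le_eq)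
    moreover have "(\<Sum>i<m-k. row_length (r # P) i) \<le> length (filter (\<lambda>p. snd p < m) (ps @ ?r))"
    proof (cases "k < m")
      case True
      then have "m - k = Suc (m - Suc k)" by simp
      then have "(\<Sum>i<m-k. row_length (r # P) i) = length r + (\<Sum>i<m-Suc k. row_length P i)"
        by (simp only: sum.lessThan_Suc_shift row_length_simps)
      moreover have "filter (\<lambda>p. snd p < m) ?r = ?r" using True by (simp add: filter_id_conv)
      ultimately show ?thesis using ps(4) by (simp del: filter_map)
    qed simp
    ultimately show ?case
      using ps by (intro exI[of _ "ps @ ?r"]) (auto simp: comp_def Suc_le_eq less_imp_le)
  qed simp
  from this[of 0] show ?thesis
    unfolding has_chains_def by auto
qed

text \<open>
  Comparison of two sets of boxes \<open>(row, column)\<close> column by column.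
\<close>

lemma card_le_by_columns:
  fixes C D :: "(nat \<times> nat) set"
  assumes "finite C" "finite D" "\<And>j. card {i. (i, j) \<in> C} \<le> card {i. (i, j) \<in> D}"
  shows "card C \<le> card D"
proof -
  have eq: "card X = (\<Sum>j\<in>snd ` (C \<union> D). card {i. (i, j) \<in> X})" if "X \<subseteq> C \<union> D" for X
  proof -
    have fin: "finite X" using that assms by (meson finite_UnI finite_subset)
    have "bij_betw (\<lambda>(j, i). (i, j)) (SIGMA j:snd ` (C \<union> D). {i. (i, j) \<in> X}) X"
      using that by (auto simp: bij_betw_def inj_on_def image_iff) (metis in_mono snd_conv Un_iff)+
    then have "card X = card (SIGMA j:snd ` (C \<union> D). {i. (i, j) \<in> X})"
      by (simp add: bij_betw_same_card)
    also have "\<dots> = (\<Sum>j\<in>snd ` (C \<union> D). card {i. (i, j) \<in> X})"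
    proof (rule card_SigmaI)
      have "{i. (i, j) \<in> X} \<subseteq> fst ` X" for j by force
      then show "\<forall>j\<in>snd ` (C \<union> D). finite {i. (i, j) \<in> X}"
        using fin by (meson finite_imageI finite_subset)
    qed (use assms in auto)
    finally show ?thesis .
  qed
  show ?thesis
    unfolding eq[OF Un_upper1] eq[OF Un_upper2] by (intro sum_mono assms)
qed

lemma length_filter_concat_rev:
  "length (filter Q (concat (rev pss))) = card {(i, j). i < length pss \<and> j < length (pss ! i) \<and> Q (pss ! i ! j)}"
proof -
  have "length (filter Q (concat (rev pss))) = (\<Sum>p\<leftarrow>pss. length (filter Q p))"
    by (induction pss) auto
  also have "\<dots> = (\<Sum>i<length pss. length (filter Q (pss ! i)))"
    by (simp add: sum_list_sum_nth atLeast0LessThan)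
  also have "\<dots> = (\<Sum>i<length pss. card {j. j < length (pss ! i) \<and> Q (pss ! i ! j)})"
    by (simp add: length_filter_conv_card)
  also have "\<dots> = card (SIGMA i:{..<length pss}. {j. j < length (pss ! i) \<and> Q (pss ! i ! j)})"
    by simp
  finally show ?thesis by (simp add: Sigma_def) (rule arg_cong[of _ _ card]; auto)
qed

lemma reading_word_chains_le:
  assumes "standard_tableau P" "has_chains m s (concat (rev P))"
  shows "s \<le> (\<Sum>i<m. row_length P i)"
proof -
  obtain ps where ps: "map fst ps = concat (rev P)" "sorted_wrt (chain_rel m) ps"
      "s \<le> length (filter (\<lambda>p. snd p < m) ps)"
    using assms(2) unfolding has_chains_def by blast
  from ps(1) obtain yss where "ps = concat yss" "map (map fst) yss = rev P"
    by (rule map_eq_concat_splitE)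
  then obtain pss where pss: "ps = concat (rev pss)" "map (map fst) pss = P"
    by (metis rev_map rev_rev_ident)
  \<comment> \<open>The boxes on chains, to be compared with the boxes in the first \<open>m\<close> rows.\<close>
  define C where "C = {(i, j). i < length pss \<and> j < length (pss ! i) \<and> snd (pss ! i ! j) < m}"
  define D where "D = {(i, j). i < m \<and> i < length P \<and> j < length (P ! i)}"
  have len: "length pss = length P" "\<And>i. i < length P \<Longrightarrow> length (pss ! i) = length (P ! i)"
    and fst: "\<And>i j. i < length P \<Longrightarrow> j < length (P ! i) \<Longrightarrow> fst (pss ! i ! j) = P ! i ! j"
    using pss(2) by auto
  have column: "length (P ! i') \<le> length (P ! i)" "j < length (P ! i') \<Longrightarrow> P ! i ! j < P ! i' ! j"
    if "i < i'" "i' < length P" for i i' j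
    using assms(1) that sorted_wrt_nth_less[of column_strict P i i']
    unfolding standard_tableau_iff column_strict_iff by auto
  have finD: "finite D" unfolding D_def
    by (rule finite_subset[of _ "SIGMA i:{..<length P}. {..<length (P ! i)}"]) auto
  have finC: "finite C" unfolding C_def
    by (rule finite_subset[of _ "SIGMA i:{..<length pss}. {..<length (pss ! i)}"]) auto
  have "card {i. (i, j) \<in> C} \<le> card {i. (i, j) \<in> D}" for j
  proof (cases "{i. (i, j) \<in> C} \<subseteq> {..<m}")
    case True
    then have "{i. (i, j) \<in> C} \<subseteq> {i. (i, j) \<in> D}"
      using len by (auto simp: C_def D_def)
    then show ?thesis
      by (rule card_mono[rotated]) (auto simp: D_def)
  next
    case False
    then obtain i0 where "(i0, j) \<in> C" "\<not> i0 < m" by auto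
    then have i0: "i0 < length P" "j < length (P ! i0)" "m \<le> i0"
      using len by (auto simp: C_def)
    have "{..<m} \<subseteq> {i. (i, j) \<in> D}"
      using i0 column(1) by (auto simp: D_def) (metis order_less_le_trans)
    then have "m \<le> card {i. (i, j) \<in> D}"
      using card_mono[of "{i. (i, j) \<in> D}" "{..<m}"] by (auto simp: D_def)
    moreover have "card {i. (i, j) \<in> C} \<le> m"
    proof -
      \<comment> \<open>The reading word runs upwards through a column, so that its letters decrease.\<close>
      have "inj_on (\<lambda>i. snd (pss ! i ! j)) {i. (i, j) \<in> C}"
      proof (rule linorder_inj_onI)
        fix i i' assume "i < i'" "i \<in> {i. (i, j) \<in> C}" "i' \<in> {i. (i, j) \<in> C}"
        then have i: "i < i'" "i' < length P" "j < length (P ! i)" "j < length (P ! i')" "snd (pss ! i ! j) < m"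
          using len by (auto simp: C_def)
        have "sorted_wrt (\<lambda>xs ys. \<forall>x\<in>set xs. \<forall>y\<in>set ys. chain_rel m x y) (rev pss)"
          using ps(2) unfolding pss(1) sorted_wrt_concat by blast
        then have "\<forall>x\<in>set (pss ! i'). \<forall>y\<in>set (pss ! i). chain_rel m x y"
          unfolding sorted_wrt_rev using i(1,2) len by (metis (no_types, lifting) sorted_wrt_nth_less)
        then have "chain_rel m (pss ! i' ! j) (pss ! i ! j)"
          using i len by simp
        moreover have "fst (pss ! i ! j) < fst (pss ! i' ! j)"
          using fst i column(2) by simp
        ultimately show "snd (pss ! i ! j) \<noteq> snd (pss ! i' ! j)"
          using i(5) by (auto simp: chain_rel_def)
      qed auto
      moreover have "(\<lambda>i. snd (pss ! i ! j)) ` {i. (i, j) \<in> C} \<subseteq> {..<m}"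
        by (auto simp: C_def)
      ultimately show ?thesis
        using card_inj_on_le[of _ "{i. (i, j) \<in> C}" "{..<m}"] by auto
    qed
    ultimately show ?thesis by simp
  qed
  then have "card C \<le> card D"
    by (rule card_le_by_columns[OF finC finD])
  moreover have "length (filter (\<lambda>p. snd p < m) ps) = card C"
    unfolding pss(1) C_def by (rule length_filter_concat_rev)
  moreover have "card D = (\<Sum>i<m. row_length P i)"
  proof -
    have "D = (SIGMA i:{..<m}. {..<row_length P i})"
      by (auto simp: D_def row_length_def split: if_splits)
    then show ?thesis by simp
  qed
  ultimately show ?thesis using ps(3) by simp
qed

text \<open>Greene's theorem for words without repeated letters.\<close>

theorem has_chains_iff:
  assumes "distinct u"
  shows "has_chains m s u \<longleftrightarrow> s \<le> (\<Sum>i<m. row_length (insert_word [] u) i)"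
proof -
  let ?P = "insert_word [] u"
  have P: "standard_tableau ?P" "chain_equiv u (concat (rev ?P))"
    using insert_word_standard[of "[]" u] assms by auto
  have "has_chains m s u \<longleftrightarrow> has_chains m s (concat (rev ?P))"
    using P(2) unfolding chain_equiv_def by (metis append_Nil append_Nil2)
  moreover have "has_chains m (\<Sum>i<m. row_length ?P i) (concat (rev ?P))"
    using P(1) by (intro reading_word_has_chains) (simp add: standard_tableau_iff)
  ultimately show ?thesis
    using reading_word_chains_le[OF P(1)] by (auto simp: has_chains_def) (meson order_trans)
qed

section \<open>Words composed of descending blocks\<close>

text \<open>
  For a list of descending blocks the sum below is an upper bound for the size of \<open>m\<close> disjoint chains; the
  list is saturated if the bound is attained for every \<open>m\<close>.
\<close>

definition saturated :: "nat list list \<Rightarrow> bool"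
  where "saturated bs \<longleftrightarrow> (\<forall>m. has_chains m (\<Sum>b\<leftarrow>bs. min (length b) m) (concat bs))"

lemma descending_chains_le:
  assumes "sorted_wrt (>) (map fst ps)" "sorted_wrt (chain_rel m) ps"
  shows "length (filter (\<lambda>p. snd p < m) ps) \<le> min (length ps) m"
proof -
  have "distinct (map snd (filter (\<lambda>p. snd p < m) ps))"
    using assms
  proof (induction ps)
    case (Cons p ps)
    have "snd p \<noteq> snd q" if "q \<in> set ps" "snd q < m" for q
      using Cons.prems that by (fastforce simp: chain_rel_def)
    with Cons show ?case by auto
  qed simp
  then have "length (filter (\<lambda>p. snd p < m) ps) = card (snd ` set (filter (\<lambda>p. snd p < m) ps))"
    using distinct_card[of "map snd (filter (\<lambda>p. snd p < m) ps)"] by simp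
  also have "\<dots> \<le> card {..<m}"
    by (rule card_mono) auto
  finally show ?thesis by simp
qed

lemma block_chains_le:
  assumes "\<forall>b\<in>set bs. sorted_wrt (>) b" "has_chains m s (concat bs)"
  shows "s \<le> (\<Sum>b\<leftarrow>bs. min (length b) m)"
proof -
  obtain ps where ps: "map fst ps = concat bs" "sorted_wrt (chain_rel m) ps"
      "s \<le> length (filter (\<lambda>p. snd p < m) ps)"
    using assms(2) unfolding has_chains_def by blast
  from ps(1) obtain pss where pss: "ps = concat pss" "map (map fst) pss = bs"
    by (rule map_eq_concat_splitE)
  have "length (filter (\<lambda>p. snd p < m) (concat qss)) \<le> (\<Sum>b\<leftarrow>map (map fst) qss. min (length b) m)"
    if "set qss \<subseteq> set pss" for qss
    using that
  proof (induction qss)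
    case (Cons q qss)
    have "sorted_wrt (>) (map fst q)" "sorted_wrt (chain_rel m) q"
      using Cons.prems assms(1) pss ps(2) by (auto simp: sorted_wrt_concat)
    then have "length (filter (\<lambda>p. snd p < m) q) \<le> min (length q) m"
      by (rule descending_chains_le)
    moreover have "length (filter (\<lambda>p. snd p < m) (concat qss)) \<le> (\<Sum>b\<leftarrow>map (map fst) qss. min (length b) m)"
      using Cons.prems by (intro Cons.IH) auto
    ultimately have "length (filter (\<lambda>p. snd p < m) q) + length (filter (\<lambda>p. snd p < m) (concat qss)) \<le>
        min (length q) m + (\<Sum>b\<leftarrow>map (map fst) qss. min (length b) m)"
      by (rule add_mono)
    then show ?case by (simp only: list.map concat.simps filter_append length_append length_map sum_list.Cons)
  qed simp
  with ps(3) pss show ?thesis by fastforce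
qed

lemma has_chains_append_blocks:
  assumes "\<forall>b\<in>set cs. sorted_wrt (>) b"
    and "has_chains m (s + (\<Sum>b\<leftarrow>cs. min (length b) m)) (u @ concat cs)"
  shows "has_chains m s u"
proof -
  obtain ps where ps: "map fst ps = u @ concat cs" "sorted_wrt (chain_rel m) ps"
      "s + (\<Sum>b\<leftarrow>cs. min (length b) m) \<le> length (filter (\<lambda>p. snd p < m) ps)"
    using assms(2) unfolding has_chains_def by blast
  then obtain qs rs where split: "ps = qs @ rs" "map fst qs = u" "map fst rs = concat cs"
    by (metis map_eq_append_conv)
  have "has_chains m (length (filter (\<lambda>p. snd p < m) rs)) (concat cs)"
    by (rule has_chainsI[OF _ order_refl split(3)]) (use ps split in \<open>simp add: sorted_wrt_append\<close>)
  then have "length (filter (\<lambda>p. snd p < m) rs) \<le> (\<Sum>b\<leftarrow>cs. min (length b) m)"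
    by (rule block_chains_le[OF assms(1)])
  then show ?thesis
    by (intro has_chainsI[OF _ _ split(2)]) (use ps split in \<open>simp_all add: sorted_wrt_append\<close>)
qed

lemma saturated_butlast:
  assumes "\<forall>b\<in>set (bs @ [b]). sorted_wrt (>) b" "saturated (bs @ [b])"
  shows "saturated bs"
  using assms has_chains_append_blocks[of "[b]"] unfolding saturated_def by simp

lemma saturated_row_sums:
  assumes "\<forall>b\<in>set bs. sorted_wrt (>) b" "distinct (concat bs)" "saturated bs"
  shows "(\<Sum>i<m. row_length (insert_word [] (concat bs)) i) = (\<Sum>b\<leftarrow>bs. min (length b) m)"
proof (rule antisym)
  show "(\<Sum>i<m. row_length (insert_word [] (concat bs)) i) \<le> (\<Sum>b\<leftarrow>bs. min (length b) m)"
    by (rule block_chains_le[OF assms(1)]) (simp add: has_chains_iff assms(2))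
  show "(\<Sum>b\<leftarrow>bs. min (length b) m) \<le> (\<Sum>i<m. row_length (insert_word [] (concat bs)) i)"
    using assms(3) by (simp add: saturated_def has_chains_iff[OF assms(2)])
qed

lemma sum_min_length_eq:
  fixes bs bs' :: "'a list list"
  assumes "map length bs = map length bs'"
  shows "(\<Sum>b\<leftarrow>bs. min (length b) m) = (\<Sum>b\<leftarrow>bs'. min (length b) m)"
proof -
  have "(\<Sum>b\<leftarrow>cs. min (length b) m) = (\<Sum>l\<leftarrow>map length cs. min l m)" for cs :: "'a list list"
    by (simp add: comp_def)
  from this[of bs] this[of bs'] show ?thesis using assms by simp
qed

lemma saturated_row_length_eq:
  assumes "\<forall>b\<in>set bs. sorted_wrt (>) b" "distinct (concat bs)" "saturated bs"
    and "\<forall>b\<in>set bs'. sorted_wrt (>) b" "distinct (concat bs')" "saturated bs'"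
    and "map length bs = map length bs'"
  shows "row_length (insert_word [] (concat bs)) i = row_length (insert_word [] (concat bs')) i"
proof -
  have eq: "(\<Sum>i<m. row_length (insert_word [] (concat bs)) i) =
      (\<Sum>i<m. row_length (insert_word [] (concat bs')) i)" for m
    using saturated_row_sums[OF assms(1-3)] saturated_row_sums[OF assms(4-6)]
      sum_min_length_eq[OF assms(7)] by simp
  from eq[of i] eq[of "Suc i"] show ?thesis by simp
qed

text \<open>
  The shapes of the tableaux at the ends of the blocks are forced, and within a descending block the
  rows of the new boxes increase; this determines the order in which all boxes are added.
\<close>

lemma saturated_growth_rows_eq:
  assumes "\<forall>b\<in>set bs. sorted_wrt (>) b" "distinct (concat bs)" "saturated bs"
    and "\<forall>b\<in>set bs'. sorted_wrt (>) b" "distinct (concat bs')" "saturated bs'"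
    and "map length bs = map length bs'"
  shows "growth_rows [] (concat bs) = growth_rows [] (concat bs')"
  using assms
proof (induction bs arbitrary: bs' rule: rev_induct)
  case Nil
  then show ?case by simp
next
  case (snoc b bs)
  then obtain cs c where bs': "bs' = cs @ [c]"
    by (cases bs' rule: rev_exhaust) auto
  let ?P = "insert_word [] (concat bs)" and ?P' = "insert_word [] (concat cs)"
  have IH: "growth_rows [] (concat bs) = growth_rows [] (concat cs)"
    using snoc.prems bs' saturated_butlast by (intro snoc.IH) auto
  have "row_length (insert_word ?P b) i = row_length (insert_word ?P' c) i" for i
    using saturated_row_length_eq[OF snoc.prems, of i] by (simp add: bs' insert_word_append)
  then have "count_list (growth_rows ?P b) i = count_list (growth_rows ?P' c) i" for i
    using IH by (simp add: row_length_insert_word)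
  then have "set (growth_rows ?P b) = set (growth_rows ?P' c)"
    by (metis count_list_0_iff subsetI subset_antisym)
  moreover have "sorted_wrt (<) (growth_rows ?P b)" "sorted_wrt (<) (growth_rows ?P' c)"
    using snoc.prems bs' by (auto intro: growth_rows_descending)
  ultimately have "growth_rows ?P b = growth_rows ?P' c"
    by (simp add: strict_sorted_equal)
  with IH show ?case by (simp add: bs' growth_rows_append)
qed

lemma saturated_if_row_length_eq:
  assumes "distinct (concat bs)" "saturated bs" "distinct (concat bs')"
    and "map length bs = map length bs'"
    and "row_length (insert_word [] (concat bs)) = row_length (insert_word [] (concat bs'))"
  shows "saturated bs'"
  using assms(2) unfolding saturated_def has_chains_iff[OF assms(1)] has_chains_iff[OF assms(3)]
  by (simp add: assms(5) sum_min_length_eq[OF assms(4)])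

text \<open>
  A colouring of the letters by which the bound for \<open>m\<close> chains is attained in each block. Colours depend
  on the letter, which is harmless for words without repetition.
\<close>

definition block_colouring :: "nat \<Rightarrow> (nat \<Rightarrow> nat) \<Rightarrow> nat list list \<Rightarrow> bool"
  where "block_colouring m g bs \<longleftrightarrow>
    (\<forall>k l a b. k < l \<longrightarrow> l < length bs \<longrightarrow> a \<in> set (bs ! k) \<longrightarrow> b \<in> set (bs ! l) \<longrightarrow>
      g a = g b \<longrightarrow> g a < m \<longrightarrow> a < b) \<and>
    (\<forall>k<length bs. inj_on g {a \<in> set (bs ! k). g a < m} \<and>
      card {a \<in> set (bs ! k). g a < m} = min (length (bs ! k)) m)"

lemma saturatedI:
  assumes desc: "\<forall>b\<in>set bs. sorted_wrt (>) b"
    and col: "\<And>m. \<exists>g. block_colouring m g bs"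
  shows "saturated bs"
  unfolding saturated_def
proof
  fix m
  from col obtain g where g: "block_colouring m g bs" by blast
  have g1: "a < b" if "k < l" "l < length bs" "a \<in> set (bs ! k)" "b \<in> set (bs ! l)" "g a = g b" "g a < m"
    for k l a b
    using g that unfolding block_colouring_def by blast
  have g2: "inj_on g {a \<in> set (bs ! k). g a < m}"
    and g3: "min (length (bs ! k)) m \<le> card {a \<in> set (bs ! k). g a < m}" if "k < length bs" for k
    using g that unfolding block_colouring_def by auto
  let ?pss = "map (map (\<lambda>a. (a, g a))) bs"
  have "sorted_wrt (chain_rel m) (concat ?pss)"
    unfolding sorted_wrt_concat
  proof (intro conjI ballI)
    fix ps assume "ps \<in> set ?pss"
    then obtain k where k: "k < length bs" "ps = map (\<lambda>a. (a, g a)) (bs ! k)"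
      by (auto simp: in_set_conv_nth)
    have "sorted_wrt (>) (bs ! k)" using desc k by simp
    then have "sorted_wrt (\<lambda>a b. chain_rel m (a, g a) (b, g b)) (bs ! k)"
      by (rule sorted_wrt_mono_rel[rotated])
         (use g2[OF k(1)] in \<open>auto simp: chain_rel_def inj_on_def\<close>)
    then show "sorted_wrt (chain_rel m) ps"
      by (simp add: k sorted_wrt_map)
  next
    show "sorted_wrt (\<lambda>xs ys. \<forall>x\<in>set xs. \<forall>y\<in>set ys. chain_rel m x y) ?pss"
      unfolding sorted_wrt_iff_nth_less
    proof (intro allI impI ballI)
      fix k l x y
      assume kl: "k < l" "l < length ?pss" and xy: "x \<in> set (?pss ! k)" "y \<in> set (?pss ! l)"
      then obtain a b where "a \<in> set (bs ! k)" "b \<in> set (bs ! l)" "x = (a, g a)" "y = (b, g b)"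
        by auto
      with g1[of k l a b] kl show "chain_rel m x y"
        by (simp add: chain_rel_def)
    qed
  qed
  moreover have "(\<Sum>b\<leftarrow>bs. min (length b) m) \<le> length (filter (\<lambda>p. snd p < m) (concat ?pss))"
  proof -
    have "min (length b) m \<le> length (filter (\<lambda>a. g a < m) b)" if "b \<in> set bs" for b
    proof -
      have "distinct b"
        using desc that strict_sorted_iff[of "rev b"] by (simp add: sorted_wrt_rev)
      obtain k where "k < length bs" "b = bs ! k" using \<open>b \<in> set bs\<close> by (auto simp: in_set_conv_nth)
      with g3[of k] \<open>distinct b\<close> distinct_card[of "filter (\<lambda>a. g a < m) b"] show ?thesis by simp
    qed
    then have "(\<Sum>b\<leftarrow>bs. min (length b) m) \<le> (\<Sum>b\<leftarrow>bs. length (filter (\<lambda>a. g a < m) b))"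
      by (intro sum_list_mono)
    also have "\<dots> = length (filter (\<lambda>p. snd p < m) (concat ?pss))"
      by (induction bs) (auto simp: filter_map comp_def)
    finally show ?thesis .
  qed
  moreover have "map fst (concat ?pss) = concat bs"
    by (simp add: map_concat comp_def)
  ultimately show "has_chains m (\<Sum>b\<leftarrow>bs. min (length b) m) (concat bs)"
    by (rule has_chainsI)
qed

lemma saturated_imp_block_colouring:
  assumes desc: "\<forall>b\<in>set bs. sorted_wrt (>) b" and dist: "distinct (concat bs)" and "saturated bs"
  shows "\<exists>g. block_colouring m g bs"
proof -
  obtain ps where ps: "map fst ps = concat bs" "sorted_wrt (chain_rel m) ps"
      "(\<Sum>b\<leftarrow>bs. min (length b) m) \<le> length (filter (\<lambda>p. snd p < m) ps)"
    using assms(3) unfolding saturated_def has_chains_def by blast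
  define g where "g = the \<circ> map_of ps"
  have "ps = map (\<lambda>a. (a, g a)) (map fst ps)"
    by (rule sym, simp add: comp_def, rule map_idI)
       (use ps(1) dist in \<open>auto simp: g_def map_of_is_SomeI\<close>)
  then have ps_eq: "ps = concat (map (map (\<lambda>a. (a, g a))) bs)"
    unfolding ps(1) by (simp add: map_concat)
  have within: "sorted_wrt (\<lambda>a b. chain_rel m (a, g a) (b, g b)) b" if "b \<in> set bs" for b
    using ps(2) that unfolding ps_eq sorted_wrt_concat by (auto simp: sorted_wrt_map)
  have across: "chain_rel m (a, g a) (b, g b)"
    if "k < l" "l < length bs" "a \<in> set (bs ! k)" "b \<in> set (bs ! l)" for k l a b
  proof -
    let ?pss = "map (map (\<lambda>a. (a, g a))) bs"
    have "sorted_wrt (\<lambda>xs ys. \<forall>x\<in>set xs. \<forall>y\<in>set ys. chain_rel m x y) ?pss"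
      using ps(2) unfolding ps_eq sorted_wrt_concat by blast
    from sorted_wrt_nth_less[OF this that(1)] show ?thesis using that by simp
  qed
  have inj: "inj_on g {a \<in> set (bs ! k). g a < m}" if k: "k < length bs" for k
  proof (rule inj_onI)
    fix x y assume xy: "x \<in> {a \<in> set (bs ! k). g a < m}" "y \<in> {a \<in> set (bs ! k). g a < m}" "g x = g y"
    then obtain i j where ij: "i < length (bs ! k)" "j < length (bs ! k)" "x = bs ! k ! i" "y = bs ! k ! j"
      by (auto simp: in_set_conv_nth)
    have *: False if "i < j" "j < length (bs ! k)" "g (bs ! k ! i) = g (bs ! k ! j)" "g (bs ! k ! i) < m" for i j
    proof -
      have "bs ! k ! j < bs ! k ! i"
        using sorted_wrt_nth_less[of "(>)" "bs ! k" i j] desc k that(1,2) by simp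
      moreover have "chain_rel m (bs ! k ! i, g (bs ! k ! i)) (bs ! k ! j, g (bs ! k ! j))"
        using sorted_wrt_nth_less[OF within[of "bs ! k"] that(1,2)] k by simp
      ultimately show False using that(3,4) by (simp add: chain_rel_def)
    qed
    show "x = y"
      using *[of i j] *[of j i] ij xy by (cases i j rule: linorder_cases) auto
  qed
  have block: "distinct (bs ! k)" if "k < length bs" for k
    using dist that by (simp add: distinct_concat_iff)
  have le: "length (filter (\<lambda>a. g a < m) (bs ! k)) \<le> min (length (bs ! k)) m" if k: "k < length bs" for k
  proof -
    have "card (g ` {a \<in> set (bs ! k). g a < m}) \<le> card {..<m}"
      by (rule card_mono) auto
    then show ?thesis
      using card_image[OF inj[OF k]] distinct_card[of "filter (\<lambda>a. g a < m) (bs ! k)"] block[OF k]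
      by simp
  qed
  have total: "(\<Sum>k<length bs. min (length (bs ! k)) m) \<le> (\<Sum>k<length bs. length (filter (\<lambda>a. g a < m) (bs ! k)))"
  proof -
    have "length (filter (\<lambda>p. snd p < m) ps) = (\<Sum>b\<leftarrow>bs. length (filter (\<lambda>a. g a < m) b))"
      unfolding ps_eq by (induction bs) (auto simp: filter_map comp_def)
    with ps(3) show ?thesis by (simp add: sum_list_sum_nth atLeast0LessThan)
  qed
  have "length (filter (\<lambda>a. g a < m) (bs ! k)) = min (length (bs ! k)) m" if k: "k < length bs" for k
  proof (rule ccontr)
    assume "\<not> ?thesis"
    with le[OF k] have "length (filter (\<lambda>a. g a < m) (bs ! k)) < min (length (bs ! k)) m" by linarith
    then have "(\<Sum>k<length bs. length (filter (\<lambda>a. g a < m) (bs ! k))) < (\<Sum>k<length bs. min (length (bs ! k)) m)"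
      using le k by (intro sum_strict_mono_ex1) auto
    with total show False by simp
  qed
  then have "card {a \<in> set (bs ! k). g a < m} = min (length (bs ! k)) m" if "k < length bs" for k
    using distinct_card[of "filter (\<lambda>a. g a < m) (bs ! k)"] block that by simp
  note card = this
  have "block_colouring m g bs"
    unfolding block_colouring_def
  proof (intro conjI allI impI)
    fix k l a b
    assume "k < l" "l < length bs" "a \<in> set (bs ! k)" "b \<in> set (bs ! l)" "g a = g b" "g a < m"
    with across[of k l a b] show "a < b" by (simp add: chain_rel_def)
  qed (use inj card in auto)
  then show ?thesis by blast
qed

section \<open>Inversions, length and the prefix order\<close>

text \<open>
  Pairs of positions, not of values: multiplication on the right permutes the values, and the pairs of
  positions inverted in a prefix remain inverted.
\<close>

definition inversions :: "nat \<Rightarrow> (nat \<Rightarrow> nat) \<Rightarrow> (nat \<times> nat) set"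
  where "inversions n w = {(p, q). 1 \<le> p \<and> p < q \<and> q \<le> n \<and> w q < w p}"

lemma finite_inversions [simp]: "finite (inversions n w)"
  by (rule finite_subset[of _ "{1..n} \<times> {1..n}"]) (auto simp: inversions_def)

lemma inversions_id: "inversions n id = {}"
  by (auto simp: inversions_def)

lemma rmult_assoc: "(x \<odot> y) \<odot> z = x \<odot> (y \<odot> z)"
  by (simp add: rmult_def comp_assoc)

lemma word_prod_Nil [simp]: "word_prod [] = id"
  by (simp add: word_prod_def)

lemma word_prod_append: "word_prod (us @ vs) = word_prod us \<odot> word_prod vs"
  by (induction us) (auto simp: word_prod_def rmult_assoc, simp add: rmult_def)

lemma word_prod_snoc: "word_prod (us @ [s]) = word_prod us \<odot> s"
  unfolding word_prod_append by (simp add: word_prod_def rmult_def)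

lemma coxeter_gen_permutes: "1 \<le> i \<Longrightarrow> i < n \<Longrightarrow> coxeter_gen i permutes {1..n}"
  unfolding coxeter_gen_def by (rule permutes_swap_id) auto

lemma coxeter_gens_permute: "s \<in> coxeter_gens n \<Longrightarrow> s permutes {1..n}"
  unfolding coxeter_gens_def using coxeter_gen_permutes by blast

lemma rmult_permutes: "x permutes S \<Longrightarrow> y permutes S \<Longrightarrow> x \<odot> y permutes S"
  unfolding rmult_def by (rule permutes_compose)

lemma word_prod_permutes: "set ws \<subseteq> coxeter_gens n \<Longrightarrow> word_prod ws permutes {1..n}"
  by (induction ws rule: rev_induct)
     (auto simp: word_prod_snoc permutes_id simp del: One_nat_def intro: rmult_permutes coxeter_gens_permute)

text \<open>
  Multiplication by \<open>s\<^sub>i\<close> on the right exchanges the values \<open>i\<close> and \<open>i + 1\<close>, here those at the positions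
  \<open>p\<close> and \<open>q\<close>; this changes the order of no other pair of positions.
\<close>

lemma inversions_rmult_coxeter_gen:
  assumes "w permutes {1..n}" "p \<in> {1..n}" "q \<in> {1..n}" "w q = Suc (w p)"
  shows "p < q \<Longrightarrow> inversions n (w \<odot> coxeter_gen (w p)) = insert (p, q) (inversions n w) \<and> (p, q) \<notin> inversions n w"
    and "q < p \<Longrightarrow> inversions n (w \<odot> coxeter_gen (w p)) = inversions n w - {(q, p)} \<and> (q, p) \<in> inversions n w"
proof -
  let ?w = "w \<odot> coxeter_gen (w p)"
  have inj: "w a = w b \<longleftrightarrow> a = b" for a b
    using permutes_inj[OF assms(1)] by (auto dest: injD)
  have val: "?w a = (if a = p then w q else if a = q then w p else w a)" for a
    unfolding rmult_def coxeter_gen_def Transposition.transpose_def using assms(4) inj[of a p] inj[of a q] by auto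
  have other: "b \<noteq> p \<Longrightarrow> w b \<noteq> w p" "b \<noteq> q \<Longrightarrow> w b \<noteq> Suc (w p)" for b
    using inj[of b p] inj[of b q] assms(4) by auto
  have cmp: "?w b < ?w a \<longleftrightarrow> w b < w a" if "\<not> (a = p \<and> b = q)" "\<not> (a = q \<and> b = p)" for a b
    unfolding val assms(4) using that other[of a] other[of b] assms(4) inj[of p q]
    by (cases "a = p"; cases "a = q"; cases "b = p"; cases "b = q"; simp; arith?)
  have pq: "?w p = Suc (w p)" "?w q = w p"
    using val[of p] val[of q] assms(4) by auto
  have mem: "(a, b) \<in> inversions n ?w \<longleftrightarrow> (a, b) \<in> inversions n w"
    if "\<not> (a = p \<and> b = q)" "\<not> (a = q \<and> b = p)" for a b
    using cmp[OF that] by (simp add: inversions_def)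
  have mem_pq: "(p, q) \<in> inversions n ?w \<longleftrightarrow> p < q" "(p, q) \<notin> inversions n w"
    "(q, p) \<notin> inversions n ?w" "(q, p) \<in> inversions n w \<longleftrightarrow> q < p"
    using assms by (auto simp: inversions_def pq)
  {
    assume "p < q"
    then have "(a, b) \<in> inversions n ?w \<longleftrightarrow> (a, b) \<in> insert (p, q) (inversions n w)" for a b
      using mem[of a b] mem_pq by (cases "a = p \<and> b = q"; cases "a = q \<and> b = p") auto
    then show "inversions n ?w = insert (p, q) (inversions n w) \<and> (p, q) \<notin> inversions n w"
      using mem_pq by auto
  next
    assume "q < p"
    then have "(a, b) \<in> inversions n ?w \<longleftrightarrow> (a, b) \<in> inversions n w - {(q, p)}" for a b
      using mem[of a b] mem_pq by (cases "a = p \<and> b = q"; cases "a = q \<and> b = p") auto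
    then show "inversions n ?w = inversions n w - {(q, p)} \<and> (q, p) \<in> inversions n w"
      using mem_pq \<open>q < p\<close> by auto
  }
qed

lemma coxeter_gen_positionsE:
  assumes "w permutes {1..n}" "s \<in> coxeter_gens n"
  obtains p q where "p \<in> {1..n}" "q \<in> {1..n}" "w q = Suc (w p)" "s = coxeter_gen (w p)"
proof -
  from assms(2) obtain i where i: "1 \<le> i" "i < n" "s = coxeter_gen i"
    by (auto simp: coxeter_gens_def)
  moreover obtain p where "w p = i" using permutes_surj[OF assms(1)] by (metis surjD)
  moreover obtain q where "w q = Suc i" using permutes_surj[OF assms(1)] by (metis surjD)
  moreover have "p \<in> {1..n}" "q \<in> {1..n}"
    using permutes_in_image[OF assms(1)] calculation by (metis Suc_leI atLeastAtMost_iff le_SucI less_imp_le_nat)+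
  ultimately show thesis using that by blast
qed

lemma card_inversions_word_prod:
  "set ws \<subseteq> coxeter_gens n \<Longrightarrow> card (inversions n (word_prod ws)) \<le> length ws"
proof (induction ws rule: rev_induct)
  case Nil
  show ?case by (simp add: inversions_id[unfolded id_def] id_def)
next
  case (snoc s ws)
  let ?w = "word_prod ws"
  have w: "?w permutes {1..n}" using snoc.prems by (intro word_prod_permutes) auto
  obtain p q where pq: "p \<in> {1..n}" "q \<in> {1..n}" "?w q = Suc (?w p)" "s = coxeter_gen (?w p)"
    using coxeter_gen_positionsE[OF w, of s] snoc.prems by auto
  have "inversions n (word_prod (ws @ [s])) \<subseteq> insert (p, q) (inversions n ?w)"
  proof (cases p q rule: linorder_cases)
    case less
    show ?thesis
      unfolding word_prod_snoc pq(4) using inversions_rmult_coxeter_gen(1)[OF w pq(1-3) less] by simp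
  next
    case equal
    with pq(3) show ?thesis by simp
  next
    case greater
    show ?thesis
      unfolding word_prod_snoc pq(4) using inversions_rmult_coxeter_gen(2)[OF w pq(1-3) greater] by auto
  qed
  then have "card (inversions n (word_prod (ws @ [s]))) \<le> card (insert (p, q) (inversions n ?w))"
    by (intro card_mono) auto
  also have "\<dots> \<le> Suc (card (inversions n ?w))"
    by (simp add: card_insert_if)
  finally have "card (inversions n (word_prod (ws @ [s]))) \<le> Suc (card (inversions n ?w))" .
  then show ?case using snoc by simp
qed

lemma strict_mono_permutation_id:
  fixes f :: "nat \<Rightarrow> nat"
  assumes "f permutes {1..n}" "\<And>i. 1 \<le> i \<Longrightarrow> i < n \<Longrightarrow> f i < f (Suc i)"
  shows "f = id"
proof -
  have ge: "1 \<le> i \<Longrightarrow> i \<le> n \<Longrightarrow> i \<le> f i" for i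
  proof (induction i)
    case (Suc i)
    show ?case
    proof (cases "i = 0")
      case True
      with Suc.prems permutes_in_image[OF assms(1), of 1] show ?thesis by simp
    next
      case False
      with Suc assms(2)[of i] show ?thesis by simp
    qed
  qed simp
  have le: "d < n \<Longrightarrow> f (n - d) \<le> n - d" for d
  proof (induction d)
    case 0
    with permutes_in_image[OF assms(1), of n] show ?case by simp
  next
    case (Suc d)
    then have "f (n - Suc d) < f (Suc (n - Suc d))" by (intro assms(2)) auto
    also have "Suc (n - Suc d) = n - d" using Suc by simp
    finally show ?case using Suc by simp
  qed
  have "f i = i" for i
  proof (cases "i \<in> {1..n}")
    case True
    with ge[of i] le[of "n - i"] show ?thesis by simp
  next
    case False
    then show ?thesis using assms(1) by (simp add: permutes_not_in)
  qed
  then show ?thesis by auto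
qed

text \<open>
  Going up from \<open>x\<close> to \<open>y\<close> in the weak order, one inversion at a time. Some step is always possible: if
  no pair of positions carrying consecutive values of \<open>x\<close> could be inverted, then \<open>x\<^sup>-\<^sup>1\<close> followed by \<open>y\<close>
  would be increasing, hence the identity.
\<close>

lemma inversions_subset_imp_word:
  assumes "x permutes {1..n}" "y permutes {1..n}" "inversions n x \<subseteq> inversions n y"
  shows "\<exists>vs. set vs \<subseteq> coxeter_gens n \<and> y = x \<odot> word_prod vs \<and>
    card (inversions n y) = card (inversions n x) + length vs"
  using assms
proof (induction "card (inversions n y) - card (inversions n x)" arbitrary: x rule: less_induct)
  case less
  show ?case
  proof (cases "\<exists>p\<in>{1..n}. \<exists>q\<in>{1..n}. p < q \<and> x q = Suc (x p) \<and> (p, q) \<in> inversions n y")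
    case True
    then obtain p q where pq: "p \<in> {1..n}" "q \<in> {1..n}" "p < q" "x q = Suc (x p)" "(p, q) \<in> inversions n y"
      by blast
    let ?s = "coxeter_gen (x p)"
    have "x p \<in> {1..n}" "x q \<in> {1..n}"
      using pq permutes_in_image[OF less.prems(1)] by blast+
    then have s: "?s \<in> coxeter_gens n"
      using pq(4) by (auto simp: coxeter_gens_def)
    note s = s coxeter_gens_permute[OF s]
    have inv: "inversions n (x \<odot> ?s) = insert (p, q) (inversions n x)" "(p, q) \<notin> inversions n x"
      using inversions_rmult_coxeter_gen(1)[OF less.prems(1) pq(1,2,4,3)] by auto
    then have card: "card (inversions n (x \<odot> ?s)) = Suc (card (inversions n x))" by simp
    have sub: "inversions n (x \<odot> ?s) \<subseteq> inversions n y" using inv less.prems pq by auto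
    have "card (inversions n (x \<odot> ?s)) \<le> card (inversions n y)"
      using sub by (intro card_mono) auto
    with card have "card (inversions n y) - card (inversions n (x \<odot> ?s)) < card (inversions n y) - card (inversions n x)"
      by simp
    from less.hyps[OF this rmult_permutes[OF less.prems(1) s(2)] less.prems(2) sub]
    obtain vs where "set vs \<subseteq> coxeter_gens n" "y = (x \<odot> ?s) \<odot> word_prod vs"
      "card (inversions n y) = card (inversions n (x \<odot> ?s)) + length vs" by blast
    then show ?thesis
      using s card by (intro exI[of _ "?s # vs"]) (auto simp: word_prod_def rmult_assoc)
  next
    case False
    let ?f = "y \<circ> inv' x"
    have "?f i < ?f (Suc i)" if i: "1 \<le> i" "i < n" for i
    proof -
      define p where "p = inv' x i"
      define q where "q = inv' x (Suc i)"
      have x: "x p = i" "x q = Suc i"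
        unfolding p_def q_def using permutes_inverses(1)[OF less.prems(1)] by auto
      have pq: "p \<in> {1..n}" "q \<in> {1..n}"
        unfolding p_def q_def using permutes_in_image[OF permutes_inv[OF less.prems(1)]] i by auto
      have "p \<noteq> q" using x by auto
      then have neq: "y p \<noteq> y q"
        using permutes_inj[OF less.prems(2)] by (auto dest: injD)
      show ?thesis
      proof (cases "p < q")
        case True
        then have "(p, q) \<notin> inversions n y" using False pq x by auto
        then show ?thesis using True pq neq by (auto simp: inversions_def p_def q_def)
      next
        case F: False
        then have "(q, p) \<in> inversions n x" using x pq \<open>p \<noteq> q\<close> by (auto simp: inversions_def)
        then have "(q, p) \<in> inversions n y" using less.prems by auto
        then show ?thesis by (auto simp: inversions_def p_def q_def)
      qed
    qed
    then have "?f = id"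
      using strict_mono_permutation_id[OF permutes_compose[OF permutes_inv[OF less.prems(1)] less.prems(2)]] by blast
    then have "y = x"
      by (metis comp_assoc comp_id id_comp less.prems(1) permutes_inv_o(2))
    then show ?thesis by (intro exI[of _ "[]"]) (auto simp: rmult_def)
  qed
qed

lemma inversions_inject:
  assumes "x permutes {1..n}" "y permutes {1..n}" "inversions n x = inversions n y"
  shows "x = y"
  using inversions_subset_imp_word[OF assms(1,2)] assms(3) by (auto simp: rmult_def)

lemma coxeter_length_eq:
  assumes "w permutes {1..n}"
  shows "coxeter_length n w = card (inversions n w)"
  unfolding coxeter_length_def
proof (rule Least_equality)
  have "inversions n id \<subseteq> inversions n w" by (simp add: inversions_id)
  then obtain vs where "set vs \<subseteq> coxeter_gens n" "w = id \<odot> word_prod vs"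
      "card (inversions n w) = card (inversions n id) + length vs"
    using inversions_subset_imp_word[OF permutes_id assms] by blast
  then show "\<exists>ws. is_expression n ws w \<and> length ws = card (inversions n w)"
    by (intro exI[of _ vs]) (simp add: is_expression_def rmult_def inversions_id)
next
  fix k assume "\<exists>ws. is_expression n ws w \<and> length ws = k"
  then show "card (inversions n w) \<le> k"
    using card_inversions_word_prod by (auto simp: is_expression_def)
qed

lemma reduced_expression_iff:
  "reduced_expression n ws w \<longleftrightarrow>
    set ws \<subseteq> coxeter_gens n \<and> word_prod ws = w \<and> length ws = card (inversions n w)"
  using coxeter_length_eq word_prod_permutes unfolding reduced_expression_def is_expression_def by auto

lemma inversions_reduced_append:
  assumes "set (us @ vs) \<subseteq> coxeter_gens n" "length (us @ vs) = card (inversions n (word_prod (us @ vs)))"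
  shows "inversions n (word_prod us) \<subseteq> inversions n (word_prod (us @ vs))"
  using assms
proof (induction vs rule: rev_induct)
  case (snoc s vs)
  let ?w = "word_prod (us @ vs)"
  have w: "?w permutes {1..n}" using snoc.prems by (intro word_prod_permutes) auto
  obtain p q where pq: "p \<in> {1..n}" "q \<in> {1..n}" "?w q = Suc (?w p)" "s = coxeter_gen (?w p)"
    using coxeter_gen_positionsE[OF w, of s] snoc.prems by auto
  have prod: "word_prod (us @ vs @ [s]) = ?w \<odot> s"
    using word_prod_snoc[of "us @ vs" s] by simp
  have le: "card (inversions n ?w) \<le> length (us @ vs)"
    using snoc.prems by (intro card_inversions_word_prod) auto
  have "p \<noteq> q" using pq by auto
  have "p < q"
  proof (rule ccontr)
    assume "\<not> p < q"
    then have "inversions n (?w \<odot> s) \<subseteq> inversions n ?w"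
      using inversions_rmult_coxeter_gen(2)[OF w pq(1-3)] \<open>p \<noteq> q\<close> pq(4) by auto
    then have "card (inversions n (?w \<odot> s)) \<le> card (inversions n ?w)" by (simp add: card_mono)
    with le snoc.prems(2) prod show False by simp
  qed
  then have inv: "inversions n (?w \<odot> s) = insert (p, q) (inversions n ?w)" "(p, q) \<notin> inversions n ?w"
    using inversions_rmult_coxeter_gen(1)[OF w pq(1-3)] pq(4) by auto
  then have "length (us @ vs) = card (inversions n ?w)"
    using snoc.prems(2) prod by simp
  then have "inversions n (word_prod us) \<subseteq> inversions n ?w"
    using snoc by simp
  with inv prod show ?case by auto
qed simp

text \<open>The prefix order is the weak order: inclusion of the sets of inverted pairs of positions.\<close>

lemma is_prefix_iff:
  assumes "x permutes {1..n}" "y permutes {1..n}"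
  shows "is_prefix n x y \<longleftrightarrow> inversions n x \<subseteq> inversions n y"
proof
  assume "is_prefix n x y"
  then show "inversions n x \<subseteq> inversions n y"
    unfolding is_prefix_def reduced_expression_iff using inversions_reduced_append by metis
next
  assume sub: "inversions n x \<subseteq> inversions n y"
  obtain us where us: "set us \<subseteq> coxeter_gens n" "x = id \<odot> word_prod us" "card (inversions n x) = length us"
    using inversions_subset_imp_word[OF permutes_id assms(1)] by (auto simp: inversions_id)
  obtain vs where "set vs \<subseteq> coxeter_gens n" "y = x \<odot> word_prod vs"
      "card (inversions n y) = card (inversions n x) + length vs"
    using inversions_subset_imp_word[OF assms sub] by blast
  with us show "is_prefix n x y"
    unfolding is_prefix_def reduced_expression_iff
    by (intro exI[of _ us] exI[of _ vs]) (auto simp: word_prod_append rmult_def)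
qed

text \<open>Exchanging two adjacent positions that are out of order removes an inversion.\<close>

lemma card_inversions_adjacent_swap:
  assumes "w permutes {1..n}" "1 \<le> i" "i < n" "w (Suc i) < w i"
  shows "card (inversions n (coxeter_gen i \<odot> w)) < card (inversions n w)"
proof -
  let ?s = "coxeter_gen i"
  let ?f = "\<lambda>(p, q). (?s p, ?s q)"
  have inj: "inj ?s" using permutes_inj[OF coxeter_gen_permutes[OF assms(2,3)]] .
  have "?f ` inversions n (?s \<odot> w) \<subseteq> inversions n w - {(i, Suc i)}"
  proof clarify
    fix p q assume pq: "(p, q) \<in> inversions n (?s \<odot> w)"
    have "?s p \<in> {1..n}" "?s q \<in> {1..n}"
      using pq permutes_in_image[OF coxeter_gen_permutes[OF assms(2,3)]] by (auto simp: inversions_def)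
    with pq assms show "(?s p, ?s q) \<in> inversions n w - {(i, Suc i)}"
      by (auto simp: inversions_def rmult_def coxeter_gen_def Transposition.transpose_def split: if_splits)
  qed
  then have "card (?f ` inversions n (?s \<odot> w)) \<le> card (inversions n w - {(i, Suc i)})"
    by (intro card_mono) auto
  moreover have "card (?f ` inversions n (?s \<odot> w)) = card (inversions n (?s \<odot> w))"
    by (rule card_image) (use inj in \<open>auto simp: inj_on_def inj_def\<close>)
  moreover have "(i, Suc i) \<in> inversions n w"
    using assms by (auto simp: inversions_def)
  then have "card (inversions n w - {(i, Suc i)}) < card (inversions n w)"
    by (intro psubset_card_mono) auto
  ultimately show ?thesis by simp
qed

section \<open>The Young subgroup and its coset representatives\<close>

text \<open>
  The blocks of a composition are the intervals of positions \<open>{offset k + 1..offset (k + 1)}\<close>, with \<open>k\<close>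
  counted from \<open>0\<close>.
\<close>

locale fixed_composition =
  fixes n :: nat and lam :: "nat list"
  assumes comp: "composition lam n"
begin

definition offset :: "nat \<Rightarrow> nat"
  where "offset k = sum_list (take k lam)"

text \<open>
  The block that contains position \<open>p\<close>; meaningful for positions in \<open>{1..n}\<close> only.
\<close>

definition block :: "nat \<Rightarrow> nat"
  where "block p = (LEAST k. p \<le> offset (Suc k))"

lemma part_pos: "k < length lam \<Longrightarrow> 0 < lam ! k"
  using comp by (auto simp: composition_def)

lemma offset_0 [simp]: "offset 0 = 0"
  by (simp add: offset_def)

lemma offset_Suc: "k < length lam \<Longrightarrow> offset (Suc k) = offset k + lam ! k"
  by (simp add: offset_def take_Suc_conv_app_nth)

lemma offset_length: "length lam \<le> k \<Longrightarrow> offset k = n"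
  using comp by (simp add: offset_def composition_def)

lemma offset_mono: "k \<le> l \<Longrightarrow> offset k \<le> offset l"
proof -
  assume "k \<le> l"
  then have "take l lam = take k lam @ take (l - k) (drop k lam)"
    by (metis le_add_diff_inverse take_add)
  then show ?thesis by (simp add: offset_def)
qed

lemma offset_le: "offset k \<le> n"
  using offset_mono[of k "length lam + k"] offset_length[of "length lam + k"] by simp

lemma block_eqI: "offset k < p \<Longrightarrow> p \<le> offset (Suc k) \<Longrightarrow> block p = k"
  unfolding block_def
proof (rule Least_equality)
  fix l assume "offset k < p" "p \<le> offset (Suc l)"
  then show "k \<le> l" using offset_mono[of "Suc l" k] by (meson leD not_less_eq_eq order_trans)
qed

lemma block_bounds:
  assumes "p \<in> {1..n}"
  shows "offset (block p) < p" "p \<le> offset (Suc (block p))" "block p < length lam"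
proof -
  have ex: "p \<le> offset (Suc (length lam))"
    using assms by (simp add: offset_length)
  show le: "p \<le> offset (Suc (block p))"
    unfolding block_def by (rule LeastI[of _ "length lam"]) (rule ex)
  show lt: "offset (block p) < p"
  proof (cases "block p")
    case 0
    with assms show ?thesis by simp
  next
    case (Suc k)
    then have "\<not> p \<le> offset (Suc k)"
      using not_less_Least[of k "\<lambda>k. p \<le> offset (Suc k)"] unfolding block_def by simp
    with Suc show ?thesis by simp
  qed
  show "block p < length lam"
  proof (rule ccontr)
    assume "\<not> ?thesis"
    with lt offset_length[of "block p"] assms show False by simp
  qed
qed

lemma block_mono:
  assumes "p \<le> q" "p \<in> {1..n}" "q \<in> {1..n}"
  shows "block p \<le> block q"
proof (rule ccontr)
  assume "\<not> ?thesis"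
  then have "offset (Suc (block q)) \<le> offset (block p)" by (intro offset_mono) simp
  with block_bounds[OF assms(2)] block_bounds[OF assms(3)] assms(1) show False by simp
qed

lemma block_pos: "k < length lam \<Longrightarrow> i < lam ! k \<Longrightarrow> block (offset k + Suc i) = k \<and> offset k + Suc i \<in> {1..n}"
  using block_eqI[of k "offset k + Suc i"] offset_Suc[of k] offset_le[of "Suc k"] by auto

lemma coxeter_gen_inject: "coxeter_gen i = coxeter_gen j \<longleftrightarrow> i = j"
proof
  assume "coxeter_gen i = coxeter_gen j"
  then have "coxeter_gen i i = coxeter_gen j i" "coxeter_gen i j = coxeter_gen j j" by simp_all
  then show "i = j" unfolding coxeter_gen_def Transposition.transpose_def
    by (auto split: if_splits)
qed simp

lemma block_Suc_neq_iff:
  assumes "1 \<le> i" "i < n"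
  shows "block i \<noteq> block (Suc i) \<longleftrightarrow> (\<exists>j. 1 \<le> j \<and> j < length lam \<and> i = offset j)"
proof
  assume neq: "block i \<noteq> block (Suc i)"
  let ?k = "block i"
  have k: "offset ?k < i" "i \<le> offset (Suc ?k)" "?k < length lam"
    using block_bounds[of i] assms by auto
  then have i: "i = offset (Suc ?k)"
    using block_eqI[of ?k "Suc i"] neq by fastforce
  moreover have "Suc ?k < length lam"
    using i assms offset_length[of "Suc ?k"] by (cases "Suc ?k < length lam") auto
  ultimately show "\<exists>j. 1 \<le> j \<and> j < length lam \<and> i = offset j"
    by (intro exI[of _ "Suc ?k"]) auto
next
  assume "\<exists>j. 1 \<le> j \<and> j < length lam \<and> i = offset j"
  then obtain k where k: "Suc k < length lam" "i = offset (Suc k)"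
    by (metis Suc_le_D One_nat_def)
  have "block i = k"
    using k offset_Suc[of k] part_pos[of k] by (intro block_eqI) auto
  moreover have "block (Suc i) = Suc k"
    using k offset_Suc[of "Suc k"] part_pos[of "Suc k"] by (intro block_eqI) auto
  ultimately show "block i \<noteq> block (Suc i)" by simp
qed

lemma J_of_iff: "s \<in> J_of n lam \<longleftrightarrow> (\<exists>i. s = coxeter_gen i \<and> 1 \<le> i \<and> i < n \<and> block i = block (Suc i))"
proof -
  have "s \<in> J_of n lam \<longleftrightarrow>
      (\<exists>i. s = coxeter_gen i \<and> 1 \<le> i \<and> i < n \<and> \<not> (\<exists>j. 1 \<le> j \<and> j < length lam \<and> i = offset j))"
    unfolding J_of_def coxeter_gens_def offset_def[symmetric] by (auto simp: coxeter_gen_inject)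
  then show ?thesis using block_Suc_neq_iff by blast
qed

text \<open>
  The permutations that preserve every block; this is \<open>W\<^sub>J\<close>.
\<close>

definition young_subgroup :: "(nat \<Rightarrow> nat) set"
  where "young_subgroup = {u. u permutes {1..n} \<and> (\<forall>p\<in>{1..n}. block (u p) = block p)}"

lemma J_of_subset_young: "J_of n lam \<subseteq> young_subgroup"
proof
  fix s assume "s \<in> J_of n lam"
  then obtain i where i: "s = coxeter_gen i" "1 \<le> i" "i < n" "block i = block (Suc i)"
    by (auto simp: J_of_iff)
  then have "block (s p) = block p" for p
    by (simp add: coxeter_gen_def Transposition.transpose_def)
  with coxeter_gen_permutes[OF i(2,3)] i(1) show "s \<in> young_subgroup"
    by (simp add: young_subgroup_def)
qed

lemma young_subgroup_comp: "u \<in> young_subgroup \<Longrightarrow> v \<in> young_subgroup \<Longrightarrow> u \<circ> v \<in> young_subgroup"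
  unfolding young_subgroup_def using permutes_in_image[of v "{1..n}"]
  by (simp add: permutes_compose del: atLeastAtMost_iff)

lemma young_subgroup_inv:
  assumes "u \<in> young_subgroup"
  shows "inv' u \<in> young_subgroup"
proof -
  have u: "u permutes {1..n}" "\<And>p. p \<in> {1..n} \<Longrightarrow> block (u p) = block p"
    using assms by (auto simp: young_subgroup_def)
  have "block (inv' u p) = block p" if "p \<in> {1..n}" for p
    using u(2)[of "inv' u p"] permutes_inverses(1)[OF u(1)] permutes_in_image[OF permutes_inv[OF u(1)]] that
    by simp
  then show ?thesis using permutes_inv[OF u(1)] by (simp add: young_subgroup_def)
qed

lemma adjacent_descentE:
  assumes "u permutes {1..n}" "u \<noteq> id"
  obtains i where "1 \<le> i" "i < n" "u (Suc i) < u i"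
proof -
  obtain i where "1 \<le> i" "i < n" "\<not> u i < u (Suc i)"
    using strict_mono_permutation_id[OF assms(1)] assms(2) by blast
  moreover have "u i \<noteq> u (Suc i)"
    using injD[OF permutes_inj[OF assms(1)], of i "Suc i"] by auto
  ultimately show thesis using that by simp
qed

lemma parabolic_eq_young_subgroup: "parabolic n (J_of n lam) = young_subgroup"
proof
  show "parabolic n (J_of n lam) \<subseteq> young_subgroup"
  proof
    fix u assume "u \<in> parabolic n (J_of n lam)"
    then show "u \<in> young_subgroup"
      unfolding parabolic_def
    proof (induction rule: generate.induct)
      case one
      then show ?case by (simp add: sym_group_one young_subgroup_def permutes_id[unfolded id_def] id_def)
    next
      case (incl h)
      then show ?case using J_of_subset_young by blast
    next
      case (inv h)
      then have "h \<in> young_subgroup" using J_of_subset_young by blast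
      moreover from this have "h \<in> carrier (sym_group n)"
        by (simp add: sym_group_carrier young_subgroup_def)
      ultimately show ?case by (simp add: young_subgroup_inv)
    next
      case (eng h1 h2)
      then show ?case
        unfolding sym_group_mult by (intro young_subgroup_comp)
    qed
  qed
next
  have "u \<in> parabolic n (J_of n lam)" if "u \<in> young_subgroup" for u
    using that
  proof (induction "card (inversions n u)" arbitrary: u rule: less_induct)
    case less
    have u: "u permutes {1..n}" "\<And>p. p \<in> {1..n} \<Longrightarrow> block (u p) = block p"
      using less.prems by (auto simp: young_subgroup_def)
    show ?case
    \<comment> \<open>An adjacent descent of \<open>u\<close> lies within a block, so it can be removed by a generator in \<open>J\<close>.\<close>
    proof (cases "u = id")
      case True
      then show ?thesis
        using generate.one[of "sym_group n" "J_of n lam"] by (simp add: parabolic_def sym_group_one)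
    next
      case False
      then obtain i where i: "1 \<le> i" "i < n" "u (Suc i) < u i"
        using adjacent_descentE[OF u(1)] by blast
      let ?s = "coxeter_gen i"
      have img: "u i \<in> {1..n}" "u (Suc i) \<in> {1..n}"
        using permutes_in_image[OF u(1), of i] permutes_in_image[OF u(1), of "Suc i"] i by simp_all
      have "block i \<le> block (Suc i)" "block (u (Suc i)) \<le> block (u i)"
        using i img by (auto intro!: block_mono)
      moreover have "block (u i) = block i" "block (u (Suc i)) = block (Suc i)"
        using i u(2) by simp_all
      ultimately have "block i = block (Suc i)" by linarith
      then have s: "?s \<in> J_of n lam" using i by (auto simp: J_of_iff)
      then have "u \<circ> ?s \<in> young_subgroup"
        using J_of_subset_young less.prems young_subgroup_comp by blast
      then have "u \<circ> ?s \<in> parabolic n (J_of n lam)"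
        using less.hyps card_inversions_adjacent_swap[OF u(1) i] by (simp add: rmult_def)
      then have "(u \<circ> ?s) \<circ> ?s \<in> parabolic n (J_of n lam)"
        unfolding parabolic_def using generate.eng[OF _ generate.incl[OF s]]
        by (metis sym_group_mult)
      moreover have "(u \<circ> ?s) \<circ> ?s = u"
        by (simp add: coxeter_gen_def comp_assoc)
      ultimately show ?thesis by simp
    qed
  qed
  then show "young_subgroup \<subseteq> parabolic n (J_of n lam)" by blast
qed

text \<open>
  The reversal of each block, which is the longest element \<open>w\<^sub>J\<close>.
\<close>

definition block_reversal :: "nat \<Rightarrow> nat"
  where "block_reversal p =
    (if p \<in> {1..n} then offset (block p) + Suc (offset (Suc (block p))) - p else p)"

lemma block_reversal_bounds:
  assumes "p \<in> {1..n}"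
  shows "offset (block p) < block_reversal p" "block_reversal p \<le> offset (Suc (block p))"
  using block_bounds[OF assms] assms by (auto simp: block_reversal_def)

lemma block_reversal_block: "p \<in> {1..n} \<Longrightarrow> block (block_reversal p) = block p"
  using block_reversal_bounds by (intro block_eqI)

lemma block_reversal_in: "p \<in> {1..n} \<Longrightarrow> block_reversal p \<in> {1..n}"
  using block_reversal_bounds[of p] offset_le[of "Suc (block p)"] by auto

lemma block_reversal_invol: "block_reversal (block_reversal p) = p"
proof (cases "p \<in> {1..n}")
  case True
  then show ?thesis
    using block_reversal_in[OF True] block_reversal_block[OF True] block_bounds[OF True]
    by (auto simp: block_reversal_def[of "block_reversal p"]) (auto simp: block_reversal_def)
qed (auto simp: block_reversal_def)

lemma block_reversal_permutes: "block_reversal permutes {1..n}"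
proof (rule bij_imp_permutes)
  show "bij_betw block_reversal {1..n} {1..n}"
    by (rule bij_betw_byWitness[where f' = block_reversal])
       (use block_reversal_in block_reversal_invol in auto)
qed (auto simp: block_reversal_def)

lemma block_reversal_in_young: "block_reversal \<in> young_subgroup"
  using block_reversal_permutes block_reversal_block by (simp add: young_subgroup_def)

lemma inversions_block_reversal:
  "inversions n block_reversal = {(p, q). 1 \<le> p \<and> p < q \<and> q \<le> n \<and> block p = block q}"
proof -
  have "block_reversal q < block_reversal p \<longleftrightarrow> block p = block q" if "1 \<le> p" "p < q" "q \<le> n" for p q
  proof -
    have pq: "p \<in> {1..n}" "q \<in> {1..n}" using that by auto
    show ?thesis
    proof
      assume "block_reversal q < block_reversal p"
      then have "block q \<le> block p"
        using block_mono[of "block_reversal q" "block_reversal p"] block_reversal_in block_reversal_block pq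
        by simp
      then show "block p = block q" using block_mono[of p q] pq that by simp
    next
      assume "block p = block q"
      then show "block_reversal q < block_reversal p"
        using block_bounds[OF pq(1)] block_bounds[OF pq(2)] pq that by (simp add: block_reversal_def)
    qed
  qed
  then show ?thesis by (auto simp: inversions_def)
qed

lemma inversions_young_subset: "u \<in> young_subgroup \<Longrightarrow> inversions n u \<subseteq> inversions n block_reversal"
proof clarify
  fix p q assume u: "u \<in> young_subgroup" and pq: "(p, q) \<in> inversions n u"
  then have *: "p \<in> {1..n}" "q \<in> {1..n}" "p < q" "u q < u p"
    by (auto simp: inversions_def)
  have "u p \<in> {1..n}" "u q \<in> {1..n}"
    using u * permutes_in_image by (fastforce simp: young_subgroup_def)+
  then have "block q \<le> block p"
    using block_mono[of "u q" "u p"] u * by (simp add: young_subgroup_def)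
  then show "(p, q) \<in> inversions n block_reversal"
    using block_mono[of p q] * by (simp add: inversions_block_reversal)
qed

lemma longest_elt_eq: "longest_elt n (J_of n lam) = block_reversal"
  unfolding longest_elt_def parabolic_eq_young_subgroup
proof (rule the_equality)
  have len: "coxeter_length n u = card (inversions n u)" if "u \<in> young_subgroup" for u
    using that coxeter_length_eq by (simp add: young_subgroup_def)
  show "block_reversal \<in> young_subgroup \<and>
      (\<forall>u\<in>young_subgroup. coxeter_length n u \<le> coxeter_length n block_reversal)"
    using block_reversal_in_young inversions_young_subset by (auto simp: len intro!: card_mono)
  fix w assume w: "w \<in> young_subgroup \<and> (\<forall>u\<in>young_subgroup. coxeter_length n u \<le> coxeter_length n w)"
  then have "card (inversions n block_reversal) \<le> card (inversions n w)"
    using block_reversal_in_young len by fastforce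
  then have "inversions n w = inversions n block_reversal"
    using w inversions_young_subset by (intro card_seteq) auto
  then show "w = block_reversal"
    using w block_reversal_permutes inversions_inject by (auto simp: young_subgroup_def)
qed

text \<open>
  Increasing on each block: the row forms of the minimal representatives of the cosets \<open>W\<^sub>J d\<close>.
\<close>

definition block_increasing :: "(nat \<Rightarrow> nat) \<Rightarrow> bool"
  where "block_increasing d \<longleftrightarrow>
    (\<forall>p q. 1 \<le> p \<longrightarrow> p < q \<longrightarrow> q \<le> n \<longrightarrow> block p = block q \<longrightarrow> d p < d q)"

lemma min_coset_reps_iff:
  "d \<in> min_coset_reps n (J_of n lam) \<longleftrightarrow> d permutes {1..n} \<and> block_increasing d"
proof
  assume "d \<in> min_coset_reps n (J_of n lam)"
  then have d: "d permutes {1..n}"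
    and min: "\<And>u. u \<in> young_subgroup \<Longrightarrow> coxeter_length n d \<le> coxeter_length n (u \<odot> d)"
    by (auto simp: min_coset_reps_def parabolic_eq_young_subgroup sym_group_carrier)
  have step: "d i < d (Suc i)" if i: "1 \<le> i" "i < n" "block i = block (Suc i)" for i
  proof (rule ccontr)
    assume "\<not> ?thesis"
    moreover have "d i \<noteq> d (Suc i)" using injD[OF permutes_inj[OF d], of i "Suc i"] by auto
    ultimately have lt: "d (Suc i) < d i" by simp
    have "coxeter_gen i \<in> young_subgroup" using i J_of_subset_young J_of_iff by blast
    from min[OF this] show False
      using card_inversions_adjacent_swap[OF d i(1,2) lt] coxeter_length_eq[OF d]
        coxeter_length_eq[OF rmult_permutes[OF coxeter_gen_permutes[OF i(1,2)] d]] by simp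
  qed
  have "1 \<le> p \<Longrightarrow> p < q \<Longrightarrow> q \<le> n \<Longrightarrow> block p = block q \<Longrightarrow> d p < d q" for p q
  proof (induction q)
    case (Suc q)
    have "block p \<le> block q" "block q \<le> block (Suc q)"
      using block_mono[of p q] block_mono[of q "Suc q"] Suc.prems by auto
    with Suc.prems have b: "block p = block q" "block q = block (Suc q)" by auto
    show ?case
    proof (cases "p = q")
      case True
      with step[of q] Suc.prems show ?thesis by simp
    next
      case False
      with Suc b have "d p < d q" by simp
      also have "d q < d (Suc q)" using step[of q] Suc.prems b by simp
      finally show ?thesis .
    qed
  qed simp
  with d show "d permutes {1..n} \<and> block_increasing d" by (simp add: block_increasing_def)
next
  assume "d permutes {1..n} \<and> block_increasing d"
  then have d: "d permutes {1..n}"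
    and inc: "\<And>p q. 1 \<le> p \<Longrightarrow> p < q \<Longrightarrow> q \<le> n \<Longrightarrow> block p = block q \<Longrightarrow> d p < d q"
    by (auto simp: block_increasing_def)
  have "coxeter_length n d \<le> coxeter_length n (u \<odot> d)" if u: "u \<in> young_subgroup" for u
  proof -
    have perm: "u permutes {1..n}" using u by (simp add: young_subgroup_def)
    have invu: "inv' u permutes {1..n}" "\<And>p. p \<in> {1..n} \<Longrightarrow> block (inv' u p) = block p"
      using young_subgroup_inv[OF u] by (auto simp: young_subgroup_def)
    \<comment> \<open>All inversions of \<open>d\<close> are between different blocks, and \<open>u\<close> preserves the order of the blocks.\<close>
    let ?f = "\<lambda>(p, q). (inv' u p, inv' u q)"
    have "?f ` inversions n d \<subseteq> inversions n (u \<odot> d)"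
    proof clarify
      fix p q assume "(p, q) \<in> inversions n d"
      then have pq: "p \<in> {1..n}" "q \<in> {1..n}" "p < q" "d q < d p" by (auto simp: inversions_def)
      have img: "inv' u p \<in> {1..n}" "inv' u q \<in> {1..n}"
        using permutes_in_image[OF invu(1)] pq by auto
      have "block p \<noteq> block q" using inc[of p q] pq by auto
      then have "inv' u p < inv' u q"
        using block_mono[of p q] block_mono[of "inv' u q" "inv' u p"] invu(2) pq img by fastforce
      with img pq show "(inv' u p, inv' u q) \<in> inversions n (u \<odot> d)"
        by (auto simp: inversions_def rmult_def permutes_inverses(1)[OF perm])
    qed
    moreover have "inj_on ?f (inversions n d)"
      using permutes_inj[OF invu(1)] by (auto simp: inj_on_def inj_def)
    ultimately have "card (inversions n d) \<le> card (inversions n (u \<odot> d))"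
      by (meson card_inj_on_le finite_inversions)
    then show ?thesis
      using coxeter_length_eq[OF d] coxeter_length_eq[OF rmult_permutes[OF perm d]] by simp
  qed
  with d show "d \<in> min_coset_reps n (J_of n lam)"
    by (simp add: min_coset_reps_def parabolic_eq_young_subgroup sym_group_carrier)
qed


section \<open>The chain description of Z\<close>

declare upt_Suc [simp del]

text \<open>
  The descending blocks of the row form of \<open>w\<^sub>J e\<close>: each block of \<open>e\<close> is read from right to left.
\<close>

definition block_words :: "(nat \<Rightarrow> nat) \<Rightarrow> nat list list"
  where "block_words e = map (\<lambda>k. map e (rev [Suc (offset k)..<Suc (offset (Suc k))])) [0..<length lam]"

lemma length_block_words [simp]: "length (block_words e) = length lam"
  by (simp add: block_words_def)

lemma nth_block_words:
  "k < length lam \<Longrightarrow> block_words e ! k = map e (rev [Suc (offset k)..<Suc (offset (Suc k))])"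
  by (simp add: block_words_def)

lemma block_reversal_interval:
  assumes "k < length lam"
  shows "map block_reversal [Suc (offset k)..<Suc (offset (Suc k))] = rev [Suc (offset k)..<Suc (offset (Suc k))]"
proof (rule nth_equalityI)
  fix i assume "i < length (map block_reversal [Suc (offset k)..<Suc (offset (Suc k))])"
  then have i: "i < lam ! k" using assms by (simp add: offset_Suc)
  have "block (offset k + Suc i) = k" "offset k + Suc i \<in> {1..n}"
    using block_pos[OF assms i] by auto
  then show "map block_reversal [Suc (offset k)..<Suc (offset (Suc k))] ! i =
      rev [Suc (offset k)..<Suc (offset (Suc k))] ! i"
    using i assms by (simp add: block_reversal_def rev_nth offset_Suc)
qed simp

lemma concat_block_words:
  "concat (block_words e) = map (block_reversal \<odot> e) [1..<Suc n]"
proof -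
  let ?I = "\<lambda>k. [Suc (offset k)..<Suc (offset (Suc k))]"
  have "concat (map ?I [0..<k]) = [1..<Suc (offset k)]" for k
  proof (induction k)
    case (Suc k)
    have "[1..<Suc (offset (Suc k))] = [1..<Suc (offset k)] @ ?I k"
      using upt_add_eq_append[of 1 "Suc (offset k)" "offset (Suc k) - offset k"] offset_mono[of k "Suc k"]
      by simp
    moreover have "[0..<Suc k] = [0..<k] @ [k]" by (simp add: upt_Suc)
    ultimately show ?case using Suc by simp
  qed simp
  then have "[1..<Suc n] = concat (map ?I [0..<length lam])"
    by (simp add: offset_length)
  then have "map (block_reversal \<odot> e) [1..<Suc n] =
      concat (map (\<lambda>k. map e (map block_reversal (?I k))) [0..<length lam])"
    by (simp add: map_concat comp_def rmult_def)
  also have "\<dots> = concat (block_words e)"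
    unfolding block_words_def by (intro arg_cong[of _ _ concat] map_cong refl) (simp add: block_reversal_interval)
  finally show ?thesis ..
qed

lemma map_length_block_words: "map length (block_words e) = lam"
  by (rule nth_equalityI) (simp_all add: nth_block_words offset_Suc)

lemma block_words_descending:
  assumes "block_increasing e"
  shows "\<forall>b\<in>set (block_words e). sorted_wrt (>) b"
proof -
  have "sorted_wrt (>) (block_words e ! k)" if k: "k < length lam" for k
  proof -
    have "sorted_wrt (\<lambda>x y. e x < e y) [Suc (offset k)..<Suc (offset (Suc k))]"
    proof (rule sorted_wrt_mono_rel[of _ "(<)"])
      fix x y assume xy: "x \<in> set [Suc (offset k)..<Suc (offset (Suc k))]"
        "y \<in> set [Suc (offset k)..<Suc (offset (Suc k))]" "x < y"
      then have "block x = k" "block y = k" by (auto intro!: block_eqI)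
      with xy assms offset_le[of "Suc k"] show "e x < e y"
        by (auto simp: block_increasing_def)
    qed simp
    then show ?thesis by (simp add: nth_block_words[OF k] sorted_wrt_rev sorted_wrt_map flip: rev_map)
  qed
  then show ?thesis by (auto simp: all_set_conv_all_nth)
qed

lemma block_words_distinct:
  assumes "e permutes {1..n}"
  shows "distinct (concat (block_words e))"
  unfolding concat_block_words
  using permutes_inj_on[OF rmult_permutes[OF block_reversal_permutes assms]] by (simp add: distinct_map)

text \<open>The \<open>i\<close>-th smallest position of the \<open>k\<close>-th block, both counted from \<open>0\<close>.\<close>

definition box :: "nat \<Rightarrow> nat \<Rightarrow> nat"
  where "box k i = offset k + Suc i"

lemma block_box: "k < length lam \<Longrightarrow> i < lam ! k \<Longrightarrow> block (box k i) = k"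
  and box_in: "k < length lam \<Longrightarrow> i < lam ! k \<Longrightarrow> box k i \<in> {1..n}"
  unfolding box_def using block_pos by auto

lemma box_exhaust:
  assumes "p \<in> {1..n}"
  obtains k i where "k < length lam" "i < lam ! k" "p = box k i"
proof
  show "block p < length lam" using block_bounds[OF assms] by simp
  show "p - Suc (offset (block p)) < lam ! block p"
    using block_bounds[OF assms] by (simp add: offset_Suc)
  show "p = box (block p) (p - Suc (offset (block p)))"
    using block_bounds[OF assms] by (simp add: box_def)
qed

lemma box_inject:
  "k < length lam \<Longrightarrow> i < lam ! k \<Longrightarrow> l < length lam \<Longrightarrow> j < lam ! l \<Longrightarrow> box k i = box l j \<longleftrightarrow> k = l \<and> i = j"
  by (metis block_box box_def add_left_cancel nat.inject)

lemma box_less_iff: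
  assumes "k < length lam" "i < lam ! k" "l < length lam" "j < lam ! l"
  shows "box k i < box l j \<longleftrightarrow> k < l \<or> (k = l \<and> i < j)"
proof -
  have less: "box k i < box l j" if "k < l" "i < lam ! k" "k < length lam" for k i l j
    using offset_Suc[of k] offset_mono[of "Suc k" l] that by (simp add: box_def)
  show ?thesis
    using less[of k l i j] less[of l k j i] assms
    by (cases k l rule: linorder_cases) (auto simp: box_def)
qed

lemma set_block_words: "k < length lam \<Longrightarrow> set (block_words e ! k) = (\<lambda>i. e (box k i)) ` {..<lam ! k}"
proof -
  assume k: "k < length lam"
  have "set (block_words e ! k) = e ` {Suc (offset k)..<Suc (offset k + lam ! k)}"
    by (simp add: nth_block_words[OF k] offset_Suc[OF k])
  also have "{Suc (offset k)..<Suc (offset k + lam ! k)} = box k ` {..<lam ! k}"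
  proof
    show "{Suc (offset k)..<Suc (offset k + lam ! k)} \<subseteq> box k ` {..<lam ! k}"
    proof
      fix p assume "p \<in> {Suc (offset k)..<Suc (offset k + lam ! k)}"
      then show "p \<in> box k ` {..<lam ! k}"
        by (intro image_eqI[of _ _ "p - Suc (offset k)"]) (auto simp: box_def)
    qed
  qed (auto simp: box_def)
  finally show ?thesis by (simp add: image_image)
qed

text \<open>
  The combinatorial content of membership in \<open>Z(\<lambda>)\<close>: for every \<open>m\<close> there are \<open>m\<close> disjoint chains, each
  increasing from block to block, that together meet every block as often as possible.
\<close>

definition box_colouring :: "nat \<Rightarrow> (nat \<Rightarrow> nat) \<Rightarrow> (nat \<Rightarrow> nat \<Rightarrow> nat) \<Rightarrow> bool"
  where "box_colouring m e c \<longleftrightarrow>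
    (\<forall>k l i j. k < l \<longrightarrow> l < length lam \<longrightarrow> i < lam ! k \<longrightarrow> j < lam ! l \<longrightarrow>
      c k i = c l j \<longrightarrow> c k i < m \<longrightarrow> e (box k i) < e (box l j)) \<and>
    (\<forall>k<length lam. inj_on (c k) {i. i < lam ! k \<and> c k i < m} \<and>
      card {i. i < lam ! k \<and> c k i < m} = min (lam ! k) m)"

lemma box_value_inject:
  assumes "e permutes {1..n}" "k < length lam" "i < lam ! k" "l < length lam" "j < lam ! l"
  shows "e (box k i) = e (box l j) \<longleftrightarrow> k = l \<and> i = j"
  using inj_eq[OF permutes_inj[OF assms(1)]] box_inject assms by simp

lemma block_colouring_imp_box_colouring:
  assumes e: "e permutes {1..n}" and g: "block_colouring m g (block_words e)"
  shows "box_colouring m e (\<lambda>k i. g (e (box k i)))"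
  unfolding box_colouring_def
proof (intro conjI allI impI)
  fix k l i j
  assume kl: "k < l" "l < length lam" "i < lam ! k" "j < lam ! l" and
    col: "g (e (box k i)) = g (e (box l j))" "g (e (box k i)) < m"
  have "k < length (block_words e)" "l < length (block_words e)"
    "e (box k i) \<in> set (block_words e ! k)" "e (box l j) \<in> set (block_words e ! l)"
    using kl set_block_words[of k e] set_block_words[of l e] by auto
  with kl(1) col show "e (box k i) < e (box l j)"
    using g unfolding block_colouring_def by blast
next
  fix k assume k: "k < length lam"
  let ?I = "{i. i < lam ! k \<and> g (e (box k i)) < m}"
  have eq: "{a \<in> set (block_words e ! k). g a < m} = (\<lambda>i. e (box k i)) ` ?I"
    by (auto simp: set_block_words[OF k])
  have inj: "inj_on (\<lambda>i. e (box k i)) ?I"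
    using box_value_inject[OF e k _ k] by (auto simp: inj_on_def)
  have "inj_on g ((\<lambda>i. e (box k i)) ` ?I)" "card ((\<lambda>i. e (box k i)) ` ?I) = min (length (block_words e ! k)) m"
    using g k unfolding block_colouring_def eq[symmetric] by auto
  then show "inj_on (\<lambda>i. g (e (box k i))) ?I" "card ?I = min (lam ! k) m"
    using comp_inj_on[OF inj] card_image[OF inj] k
    by (auto simp: comp_def nth_block_words offset_Suc)
qed

lemma box_colouring_imp_block_colouring:
  assumes e: "e permutes {1..n}" and c: "box_colouring m e c"
  shows "\<exists>g. block_colouring m g (block_words e)"
proof -
  \<comment> \<open>The colour of the box that carries the letter \<open>a\<close>.\<close>
  define g where "g a = (let p = inv' e a in c (block p) (p - Suc (offset (block p))))" for a
  have g: "g (e (box k i)) = c k i" if "k < length lam" "i < lam ! k" for k i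
  proof -
    have "inv' e (e (box k i)) = box k i" using permutes_inverses(2)[OF e] by simp
    then show ?thesis using block_box[OF that] by (simp add: g_def Let_def) (simp add: box_def)
  qed
  have "block_colouring m g (block_words e)"
    unfolding block_colouring_def
  proof (intro conjI allI impI)
    fix k l a b
    assume kl: "k < l" "l < length (block_words e)" and
      ab: "a \<in> set (block_words e ! k)" "b \<in> set (block_words e ! l)" "g a = g b" "g a < m"
    then obtain i j where ij: "i < lam ! k" "j < lam ! l" "a = e (box k i)" "b = e (box l j)"
      using set_block_words[of k e] set_block_words[of l e] by auto
    then have "c k i = c l j" "c k i < m"
      using ab(3,4) g[of k i] g[of l j] kl by auto
    then show "a < b"
      using c kl ij unfolding box_colouring_def by simp
  next
    fix k assume "k < length (block_words e)"
    then have k: "k < length lam" by simp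
    let ?I = "{i. i < lam ! k \<and> c k i < m}"
    have eq: "{a \<in> set (block_words e ! k). g a < m} = (\<lambda>i. e (box k i)) ` ?I"
      using g[OF k] by (auto simp: set_block_words[OF k])
    have inj: "inj_on (\<lambda>i. e (box k i)) ?I"
      using box_value_inject[OF e k _ k] by (auto simp: inj_on_def)
    have cc: "inj_on (c k) ?I" "card ?I = min (lam ! k) m"
      using c k unfolding box_colouring_def by auto
    show "inj_on g {a \<in> set (block_words e ! k). g a < m}"
      unfolding eq using cc(1) g[OF k] by (auto simp: inj_on_def)
    show "card {a \<in> set (block_words e ! k). g a < m} = min (length (block_words e ! k)) m"
      unfolding eq using cc(2) card_image[OF inj] k by (simp add: nth_block_words offset_Suc)
  qed
  then show ?thesis by blast
qed

lemma saturated_block_words_iff: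
  assumes "e permutes {1..n}" "block_increasing e"
  shows "saturated (block_words e) \<longleftrightarrow> (\<forall>m. \<exists>c. box_colouring m e c)"
  using saturatedI[OF block_words_descending[OF assms(2)]]
    saturated_imp_block_colouring[OF block_words_descending[OF assms(2)] block_words_distinct[OF assms(1)]]
    block_colouring_imp_box_colouring[OF assms(1)] box_colouring_imp_block_colouring[OF assms(1)]
  by blast

lemma block_increasing_iff:
  "block_increasing e \<longleftrightarrow>
    (\<forall>k i j. k < length lam \<longrightarrow> i < j \<longrightarrow> j < lam ! k \<longrightarrow> e (box k i) < e (box k j))"
proof
  assume inc: "block_increasing e"
  show "\<forall>k i j. k < length lam \<longrightarrow> i < j \<longrightarrow> j < lam ! k \<longrightarrow> e (box k i) < e (box k j)"
  proof (intro allI impI)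
    fix k i j assume a: "k < length lam" "i < j" "j < lam ! k"
    then have "i < lam ! k" by simp
    then show "e (box k i) < e (box k j)"
      using inc a block_box[of k i] block_box[of k j] box_in[of k i] box_in[of k j] box_less_iff[of k i k j]
      unfolding block_increasing_def by simp
  qed
next
  assume *: "\<forall>k i j. k < length lam \<longrightarrow> i < j \<longrightarrow> j < lam ! k \<longrightarrow> e (box k i) < e (box k j)"
  show "block_increasing e"
    unfolding block_increasing_def
  proof (intro allI impI)
    fix p q assume pq: "1 \<le> p" "p < q" "q \<le> n" "block p = block q"
    obtain k i where k: "k < length lam" "i < lam ! k" "p = box k i"
      using pq by (auto intro: box_exhaust[of p])
    obtain l j where l: "l < length lam" "j < lam ! l" "q = box l j"
      using pq by (auto intro: box_exhaust[of q])
    have "k = l" using pq(4) k l block_box by simp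
    moreover have "i < j" using pq(2) k l \<open>k = l\<close> by (simp add: box_def)
    ultimately show "e p < e q" using * k l by simp
  qed
qed

lemma saturated_id: "saturated (block_words id)"
proof -
  have "box_colouring m id (\<lambda>k i. i)" for m
    unfolding box_colouring_def
  proof (intro conjI allI impI)
    fix k l i j
    assume "k < l" "l < length lam" "i < lam ! k" "j < lam ! l"
    then show "id (box k i) < id (box l j)" using box_less_iff[of k i l j] by simp
  next
    fix k
    have "{i. i < lam ! k \<and> i < m} = {..<min (lam ! k) m}" by auto
    then show "card {i. i < lam ! k \<and> i < m} = min (lam ! k) m" by simp
  qed simp
  moreover have "block_increasing id"
    by (simp add: block_increasing_def)
  ultimately show ?thesis
    using saturated_block_words_iff[OF permutes_id] by blast
qed

theorem Z_set_iff:
  "e \<in> Z_set n lam \<longleftrightarrow>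
    e permutes {1..n} \<and> block_increasing e \<and> (\<forall>m. \<exists>c. box_colouring m e c)"
proof -
  have "right_cell_equiv n (block_reversal \<odot> e) block_reversal \<longleftrightarrow> saturated (block_words e)"
    if e: "e permutes {1..n}" "block_increasing e"
  proof
    note E = block_words_descending[OF e(2)] block_words_distinct[OF e(1)]
    have inc: "block_increasing id" by (simp add: block_increasing_def)
    note I = block_words_descending[OF inc] block_words_distinct[OF permutes_id]
    have words: "map (block_reversal \<odot> e) [1..<Suc n] = concat (block_words e)"
      "map block_reversal [1..<Suc n] = concat (block_words id)"
      unfolding concat_block_words by (simp_all add: rmult_def)
    {
      assume "saturated (block_words e)"
      then have "growth_rows [] (concat (block_words e)) = growth_rows [] (concat (block_words id))"
        using saturated_id E I by (intro saturated_growth_rows_eq) (auto simp: map_length_block_words)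
      then show "right_cell_equiv n (block_reversal \<odot> e) block_reversal"
        by (simp only: right_cell_equiv_def recording_tableau_eq words)
    next
      assume "right_cell_equiv n (block_reversal \<odot> e) block_reversal"
      then have "row_length (recording_tableau n (block_reversal \<odot> e)) = row_length (recording_tableau n block_reversal)"
        by (simp add: right_cell_equiv_def)
      then have "row_length (insert_word [] (concat (block_words id))) = row_length (insert_word [] (concat (block_words e)))"
        by (simp only: row_length_recording_tableau words)
      then show "saturated (block_words e)"
        by (intro saturated_if_row_length_eq[OF I(2) saturated_id E(2)]) (simp only: map_length_block_words)
    }
  qed
  then show ?thesis
    using saturated_block_words_iff unfolding Z_set_def longest_elt_eq
    by (auto simp: min_coset_reps_iff)
qed

end

section \<open>The two extreme elements and the rim\<close>

text \<open>
  For \<open>f\<close> injective on \<open>{1..n}\<close>, the permutation of \<open>{1..n}\<close> whose values are ordered as those of \<open>f\<close>.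
\<close>

definition rank :: "nat \<Rightarrow> (nat \<Rightarrow> nat) \<Rightarrow> nat \<Rightarrow> nat"
  where "rank n f p = (if p \<in> {1..n} then card {q \<in> {1..n}. f q \<le> f p} else p)"

lemma rank_less_iff:
  assumes "p \<in> {1..n}" "q \<in> {1..n}"
  shows "rank n f p < rank n f q \<longleftrightarrow> f p < f q"
proof -
  have "rank n f p \<le> rank n f q" if "f p \<le> f q" "p \<in> {1..n}" "q \<in> {1..n}" for p q
    using that by (auto simp: rank_def intro!: card_mono)
  moreover have "rank n f p < rank n f q" if "f p < f q" "p \<in> {1..n}" "q \<in> {1..n}" for p q
  proof -
    have "q \<in> {x \<in> {1..n}. f x \<le> f q}" "q \<notin> {x \<in> {1..n}. f x \<le> f p}"
      "{x \<in> {1..n}. f x \<le> f p} \<subseteq> {x \<in> {1..n}. f x \<le> f q}"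
      using that by auto
    then have "{x \<in> {1..n}. f x \<le> f p} \<subset> {x \<in> {1..n}. f x \<le> f q}"
      by blast
    then have "card {x \<in> {1..n}. f x \<le> f p} < card {x \<in> {1..n}. f x \<le> f q}"
      by (rule psubset_card_mono[rotated]) simp
    then show ?thesis using that by (simp add: rank_def)
  qed
  ultimately show ?thesis using assms by (meson leD leI)
qed

lemma rank_permutes:
  assumes "inj_on f {1..n}"
  shows "rank n f permutes {1..n}"
proof (rule bij_imp_permutes)
  have inj: "inj_on (rank n f) {1..n}"
  proof (rule inj_onI)
    fix p q assume pq: "p \<in> {1..n}" "q \<in> {1..n}" "rank n f p = rank n f q"
    then have "f p = f q"
      using rank_less_iff[OF pq(1,2), of f] rank_less_iff[OF pq(2,1), of f] by simp
    with assms pq show "p = q" by (auto dest: inj_onD)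
  qed
  moreover have "rank n f ` {1..n} \<subseteq> {1..n}"
  proof
    fix x assume "x \<in> rank n f ` {1..n}"
    then obtain p where p: "p \<in> {1..n}" "x = card {q \<in> {1..n}. f q \<le> f p}"
      by (auto simp: rank_def)
    have "card {p} \<le> x" "x \<le> card {1..n}"
      unfolding p(2) using p(1) by (intro card_mono; auto)+
    then show "x \<in> {1..n}" by simp
  qed
  ultimately show "bij_betw (rank n f) {1..n} {1..n}"
    by (simp add: bij_betw_def endo_inj_surj)
qed (auto simp: rank_def)

lemma div_key_less_iff:
  fixes a b k l r :: nat
  assumes "k < r" "l < r"
  shows "a * r + k < b * r + l \<longleftrightarrow> a < b \<or> (a = b \<and> k < l)"
proof -
  have "a * r + k < b * r + l" if "a < b" "k < r" for a b k l
  proof -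
    have "a * r + k < Suc a * r" using that by simp
    also have "\<dots> \<le> b * r" using that by (intro mult_le_mono1) simp
    finally show ?thesis by simp
  qed
  from this[of a b k l] this[of b a l k] show ?thesis
    using assms by (cases a b rule: linorder_cases) auto
qed

text \<open>
  A sequence that is neither weakly decreasing nor weakly increasing has a term that is larger, or smaller,
  than both an earlier and a later one.
\<close>

lemma peak_or_valley:
  fixes a :: "nat \<Rightarrow> nat"
  assumes "i < j" "j < r" "a i < a j" and "k < l" "l < r" "a l < a k"
  obtains x y z where "x < y" "y < z" "z < r" "a x < a y \<and> a z < a y \<or> a y < a x \<and> a y < a z"
proof (cases "k < j \<and> a k < a j")
  case True
  then show thesis
    using that[of k l j] that[of k j l] assms by (cases l j rule: linorder_cases) auto
next
  case False
  show thesis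
  proof (cases "a k < a j")
    case True
    with False have "j < k" by (cases j k rule: linorder_cases) auto
    with that[of i j k] assms True show thesis by auto
  next
    case F: False
    show thesis
    proof (cases "i < k")
      case True
      with that[of i k l] assms F show thesis by auto
    next
      case False
      with F assms have "k < i" by (cases i k rule: linorder_cases) auto
      with that[of k i j] assms F show thesis by auto
    qed
  qed
qed

context fixed_composition
begin

lemma lam_le: "k < length lam \<Longrightarrow> lam ! k \<le> n"
  using offset_Suc[of k] offset_le[of "Suc k"] by simp

text \<open>
  Shift the column \<open>k\<close> of the diagram down by \<open>d k\<close> and number the boxes row by row, from left to right.
\<close>

definition box_key :: "(nat \<Rightarrow> nat) \<Rightarrow> nat \<Rightarrow> nat"
  where "box_key d p = (p - Suc (offset (block p)) + d (block p)) * length lam + block p"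

lemma box_key_box: "k < length lam \<Longrightarrow> i < lam ! k \<Longrightarrow> box_key d (box k i) = (i + d k) * length lam + k"
  unfolding box_key_def by (simp add: block_box) (simp add: box_def)

text \<open>
  The permutation that numbers the boxes in this order.
\<close>

definition filling :: "(nat \<Rightarrow> nat) \<Rightarrow> nat \<Rightarrow> nat"
  where "filling d = rank n (box_key d)"

lemma filling_less_iff:
  assumes "k < length lam" "i < lam ! k" "l < length lam" "j < lam ! l"
  shows "filling d (box k i) < filling d (box l j) \<longleftrightarrow>
    i + d k < j + d l \<or> (i + d k = j + d l \<and> k < l)"
  unfolding filling_def
  using assms by (simp only: rank_less_iff[OF box_in box_in] box_key_box div_key_less_iff)

lemma filling_permutes: "filling d permutes {1..n}"
  unfolding filling_def
proof (rule rank_permutes, rule inj_onI)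
  fix p q assume pq: "p \<in> {1..n}" "q \<in> {1..n}" "box_key d p = box_key d q"
  obtain k i where k: "k < length lam" "i < lam ! k" "p = box k i"
    using box_exhaust[OF pq(1)] .
  obtain l j where l: "l < length lam" "j < lam ! l" "q = box l j"
    using box_exhaust[OF pq(2)] .
  have eq: "(i + d k) * length lam + k = (j + d l) * length lam + l"
    using pq(3) k l by (simp add: box_key_box)
  then have "i + d k = j + d l \<and> k = l"
    using div_key_less_iff[OF k(1) l(1), of "i + d k" "j + d l"] div_key_less_iff[OF l(1) k(1), of "j + d l" "i + d k"]
    by auto
  then show "p = q" using k l by auto
qed

text \<open>
  The filling lies in \<open>Z(\<lambda>)\<close> as soon as its rows can be numbered so that, for every \<open>m\<close>, the first \<open>m\<close> of
  them meet every column in as many boxes as possible.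
\<close>

lemma filling_in_Z:
  assumes "\<And>k l i j. k < length lam \<Longrightarrow> l < length lam \<Longrightarrow> i < lam ! k \<Longrightarrow> j < lam ! l \<Longrightarrow>
      c k i = c l j \<Longrightarrow> i + d k = j + d l"
    and "\<And>k m. k < length lam \<Longrightarrow> card {i. i < lam ! k \<and> c k i < m} = min (lam ! k) m"
  shows "filling d \<in> Z_set n lam"
  unfolding Z_set_iff
proof (intro conjI allI)
  show "filling d permutes {1..n}" by (rule filling_permutes)
  show "block_increasing (filling d)"
    unfolding block_increasing_iff using filling_less_iff by simp
  fix m
  have "box_colouring m (filling d) c"
    unfolding box_colouring_def
  proof (intro conjI allI impI)
    fix k l i j
    assume kl: "k < l" "l < length lam" "i < lam ! k" "j < lam ! l" "c k i = c l j"
    then show "filling d (box k i) < filling d (box l j)"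
      using assms(1)[of k l i j] filling_less_iff[of k i l j] by simp
  next
    fix k assume k: "k < length lam"
    show "inj_on (c k) {i. i < lam ! k \<and> c k i < m}"
    proof (rule inj_onI)
      fix i j assume "i \<in> {i. i < lam ! k \<and> c k i < m}" "j \<in> {i. i < lam ! k \<and> c k i < m}" "c k i = c k j"
      then show "i = j" using assms(1)[OF k k, of i j] by simp
    qed
  qed (rule assms(2))
  then show "\<exists>c. box_colouring m (filling d) c" by blast
qed

text \<open>
  The columns aligned at the top, and at the bottom (the shift \<open>n - \<lambda>\<^sub>k\<close> puts the last box of every column
  in the same row).
\<close>

definition top_filling :: "nat \<Rightarrow> nat"
  where "top_filling = filling (\<lambda>k. 0)"

definition bottom_filling :: "nat \<Rightarrow> nat"
  where "bottom_filling = filling (\<lambda>k. n - lam ! k)"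

lemma top_filling_in_Z: "top_filling \<in> Z_set n lam"
  unfolding top_filling_def
proof (rule filling_in_Z[where c = "\<lambda>k i. i"])
  fix k m
  have "{i. i < lam ! k \<and> i < m} = {..<min (lam ! k) m}" by auto
  then show "card {i. i < lam ! k \<and> i < m} = min (lam ! k) m" by simp
qed simp

lemma bottom_filling_in_Z: "bottom_filling \<in> Z_set n lam"
  unfolding bottom_filling_def
proof (rule filling_in_Z[where c = "\<lambda>k i. lam ! k - Suc i"])
  fix k l i j
  assume "k < length lam" "l < length lam" "i < lam ! k" "j < lam ! l" "lam ! k - Suc i = lam ! l - Suc j"
  then show "i + (n - lam ! k) = j + (n - lam ! l)"
    using lam_le[of k] lam_le[of l] by linarith
next
  fix k m
  have "{i. i < lam ! k \<and> lam ! k - Suc i < m} = {lam ! k - min (lam ! k) m..<lam ! k}" by auto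
  then show "card {i. i < lam ! k \<and> lam ! k - Suc i < m} = min (lam ! k) m" by simp
qed

lemma inversion_box_iff:
  assumes "k < l" "l < length lam" "i < lam ! k" "j < lam ! l"
  shows "(box k i, box l j) \<in> inversions n e \<longleftrightarrow> e (box l j) < e (box k i)"
  using assms box_in[of k i] box_in[of l j] box_less_iff[of k i l j] by (auto simp: inversions_def)

lemma top_filling_inversion_iff:
  assumes "k < l" "l < length lam" "i < lam ! k" "j < lam ! l"
  shows "(box k i, box l j) \<in> inversions n top_filling \<longleftrightarrow> j < i"
  using assms filling_less_iff[of l j k i "\<lambda>k. 0"] by (simp add: inversion_box_iff top_filling_def)

lemma bottom_filling_inversion_iff:
  assumes "k < l" "l < length lam" "i < lam ! k" "j < lam ! l"
  shows "(box k i, box l j) \<in> inversions n bottom_filling \<longleftrightarrow> j + lam ! k < i + lam ! l"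
  using assms filling_less_iff[of l j k i "\<lambda>k. n - lam ! k"] lam_le[of k] lam_le[of l]
  by (auto simp: inversion_box_iff bottom_filling_def)

lemma inversions_subset_boxesI:
  assumes "block_increasing e"
    and "\<And>k l i j. k < l \<Longrightarrow> l < length lam \<Longrightarrow> i < lam ! k \<Longrightarrow> j < lam ! l \<Longrightarrow> e (box l j) < e (box k i) \<Longrightarrow>
      (box k i, box l j) \<in> inversions n f"
  shows "inversions n e \<subseteq> inversions n f"
proof clarify
  fix p q assume inv: "(p, q) \<in> inversions n e"
  then have pq: "p \<in> {1..n}" "q \<in> {1..n}" "p < q" "e q < e p" by (auto simp: inversions_def)
  obtain k i where k: "k < length lam" "i < lam ! k" "p = box k i"
    using box_exhaust[OF pq(1)] .
  obtain l j where l: "l < length lam" "j < lam ! l" "q = box l j"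
    using box_exhaust[OF pq(2)] .
  have "k \<noteq> l"
  proof
    assume "k = l"
    then have "i < j" using pq(3) k l by (simp add: box_def)
    then have "e p < e q" using assms(1) k l \<open>k = l\<close> unfolding block_increasing_iff by blast
    with pq(4) show False by simp
  qed
  then have "k < l" using pq(3) k l box_less_iff by simp
  then show "(p, q) \<in> inversions n f" using assms(2) k l pq(4) by simp
qed

lemma box_colouring_all_coloured:
  assumes "box_colouring m e c" "k < length lam" "lam ! k \<le> m" "i < lam ! k"
  shows "c k i < m"
proof -
  have "card {i. i < lam ! k \<and> c k i < m} = card {..<lam ! k}"
    using assms unfolding box_colouring_def by simp
  then have "{i. i < lam ! k \<and> c k i < m} = {..<lam ! k}"
    by (intro card_subset_eq) auto
  with assms(4) show ?thesis by blast
qed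

lemma box_colouring_all_colours:
  assumes "box_colouring m e c" "k < length lam" "m \<le> lam ! k" "x < m"
  obtains i where "i < lam ! k" "c k i = x"
proof -
  let ?I = "{i. i < lam ! k \<and> c k i < m}"
  have "inj_on (c k) ?I" "card ?I = m"
    using assms unfolding box_colouring_def by simp_all
  then have "card (c k ` ?I) = card {..<m}" by (simp add: card_image)
  then have "c k ` ?I = {..<m}" by (intro card_subset_eq) auto
  with assms(4) have "x \<in> c k ` ?I" by simp
  with that show thesis by auto
qed

lemma box_colouring_chain:
  assumes "box_colouring m e c" "k < l" "l < length lam" "i < lam ! k" "j < lam ! l" "c k i = c l j" "c k i < m"
  shows "e (box k i) < e (box l j)"
  using assms unfolding box_colouring_def by blast

lemma box_colouring_inj:
  assumes "box_colouring m e c" "k < length lam" "i < lam ! k" "j < lam ! k" "c k i = c k j" "c k i < m"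
  shows "i = j"
  using assms inj_onD[of "c k" "{i. i < lam ! k \<and> c k i < m}" i j] unfolding box_colouring_def by simp

lemma Z_set_colouring:
  assumes "e \<in> Z_set n lam"
  obtains c where "box_colouring m e c"
  using assms unfolding Z_set_iff by blast

lemma block_increasing_le_iff:
  assumes "block_increasing e" "k < length lam" "i < lam ! k" "j < lam ! k"
  shows "e (box k i) \<le> e (box k j) \<longleftrightarrow> i \<le> j"
proof -
  have "e (box k x) < e (box k y)" if "x < y" "y < lam ! k" for x y
    using assms(1,2) that unfolding block_increasing_iff by blast
  from this[of i j] this[of j i] show ?thesis
    using assms(3,4) by (cases i j rule: linorder_cases) auto
qed

text \<open>
  With \<open>m = \<lambda>\<^sub>k\<close> chains, every box of column \<open>l\<close> is on a chain that comes from column \<open>k\<close>. If \<open>z(l, j) < z(k, i)\<close>,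
  the chains through the boxes \<open>(l, 0), \<dots>, (l, j)\<close> come from boxes above \<open>(k, i)\<close>, hence \<open>j < i\<close>.
\<close>

lemma Z_set_le_top_filling:
  assumes dec: "sorted_wrt (\<ge>) lam" and z: "z \<in> Z_set n lam"
  shows "inversions n z \<subseteq> inversions n top_filling"
proof (rule inversions_subset_boxesI)
  show inc: "block_increasing z" using z by (simp add: Z_set_iff)
  fix k l i j
  assume kl: "k < l" "l < length lam" "i < lam ! k" "j < lam ! l" and inv: "z (box l j) < z (box k i)"
  have k: "k < length lam" using kl by simp
  have le: "lam ! l \<le> lam ! k" using dec kl(1,2) by (simp add: sorted_wrt_iff_nth_less)
  obtain c where c: "box_colouring (lam ! k) z c" by (rule Z_set_colouring[OF z])
  have "\<exists>x. x < i \<and> c k x = c l y" if y: "y \<le> j" for y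
  proof -
    have cy: "c l y < lam ! k" using box_colouring_all_coloured[OF c kl(2) le] y kl(4) by simp
    obtain x where x: "x < lam ! k" "c k x = c l y"
      using box_colouring_all_colours[OF c k order_refl cy] .
    have "z (box k x) < z (box l y)"
      using box_colouring_chain[OF c kl(1,2) x(1) _ x(2)] x(2) cy y kl(4) by simp
    also have "\<dots> \<le> z (box l j)"
      using block_increasing_le_iff[OF inc kl(2)] y kl(4) by simp
    also have "\<dots> < z (box k i)" by (rule inv)
    finally have "x < i"
      using block_increasing_le_iff[OF inc k kl(3) x(1)] by simp
    with x(2) show ?thesis by blast
  qed
  then obtain f where f: "\<And>y. y \<le> j \<Longrightarrow> f y < i \<and> c k (f y) = c l y" by metis
  have "inj_on f {..j}"
  proof (rule inj_onI)
    fix x y assume xy: "x \<in> {..j}" "y \<in> {..j}" "f x = f y"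
    then have "c l x = c l y" using f[of x] f[of y] by simp
    moreover have "c l x < lam ! k" using box_colouring_all_coloured[OF c kl(2) le] xy(1) kl(4) by simp
    ultimately show "x = y"
      using box_colouring_inj[OF c kl(2)] xy kl(4) by simp
  qed
  moreover have "f ` {..j} \<subseteq> {..<i}" using f by auto
  ultimately have "card {..j} \<le> card {..<i}" by (intro card_inj_on_le) auto
  then show "(box k i, box l j) \<in> inversions n top_filling"
    by (simp add: top_filling_inversion_iff[OF kl])
qed

text \<open>
  With \<open>m = \<lambda>\<^sub>l\<close> chains, every box of column \<open>k\<close> is on a chain that goes on to column \<open>l\<close>, and the argument is
  applied to the boxes below.
\<close>

lemma Z_set_le_bottom_filling:
  assumes asc: "sorted_wrt (\<le>) lam" and z: "z \<in> Z_set n lam"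
  shows "inversions n z \<subseteq> inversions n bottom_filling"
proof (rule inversions_subset_boxesI)
  show inc: "block_increasing z" using z by (simp add: Z_set_iff)
  fix k l i j
  assume kl: "k < l" "l < length lam" "i < lam ! k" "j < lam ! l" and inv: "z (box l j) < z (box k i)"
  have k: "k < length lam" using kl by simp
  have le: "lam ! k \<le> lam ! l" using asc kl(1,2) by (simp add: sorted_wrt_iff_nth_less)
  obtain c where c: "box_colouring (lam ! l) z c" by (rule Z_set_colouring[OF z])
  have "\<exists>y. j < y \<and> y < lam ! l \<and> c k x = c l y" if x: "i \<le> x" "x < lam ! k" for x
  proof -
    have cx: "c k x < lam ! l" using box_colouring_all_coloured[OF c k le x(2)] .
    obtain y where y: "y < lam ! l" "c l y = c k x"
      using box_colouring_all_colours[OF c kl(2) order_refl cx] .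
    have "z (box l j) < z (box k i)" by (rule inv)
    also have "\<dots> \<le> z (box k x)"
      using block_increasing_le_iff[OF inc k kl(3) x(2)] x(1) by simp
    also have "\<dots> < z (box l y)"
      using box_colouring_chain[OF c kl(1,2) x(2) y(1)] y(2) cx by simp
    finally have "j < y"
      using block_increasing_le_iff[OF inc kl(2) y(1) kl(4)] by simp
    with y show ?thesis by auto
  qed
  then obtain f where f: "\<And>x. i \<le> x \<Longrightarrow> x < lam ! k \<Longrightarrow> j < f x \<and> f x < lam ! l \<and> c k x = c l (f x)" by metis
  have "inj_on f {i..<lam ! k}"
  proof (rule inj_onI)
    fix x y assume xy: "x \<in> {i..<lam ! k}" "y \<in> {i..<lam ! k}" "f x = f y"
    then have "c k x = c k y" using f[of x] f[of y] by simp
    moreover have "c k x < lam ! l" using box_colouring_all_coloured[OF c k le] xy(1) by simp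
    ultimately show "x = y"
      using box_colouring_inj[OF c k] xy by simp
  qed
  moreover have "f ` {i..<lam ! k} \<subseteq> {Suc j..<lam ! l}" using f by (auto simp: Suc_le_eq)
  ultimately have "card {i..<lam ! k} \<le> card {Suc j..<lam ! l}" by (intro card_inj_on_le) auto
  then show "(box k i, box l j) \<in> inversions n bottom_filling"
    using kl(3,4) by (simp add: bottom_filling_inversion_iff[OF kl])
qed

text \<open>
  Let \<open>a\<close>, \<open>b\<close>, \<open>c\<close> be the lengths of the three columns. At a peak, take \<open>max(a, c)\<close> chains: each of them meets
  the middle column, and the one through the first box of the third column (if \<open>c \<le> a\<close>) or through the last
  box of the first column (otherwise) meets all three columns, which the inequalities \<open>step\<close> exclude. At a
  valley, take \<open>min(a, c)\<close> chains: each of them meets the first and the third column, and since there are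
  more than \<open>b\<close>, one meets the first column in a lower row than the last box of the middle column. It
  avoids the middle column and can only reach the last box of the third, but the chain through the last box of the
  middle column also has to end there.
\<close>

lemma no_upper_bound:
  assumes y: "y \<in> Z_set n lam"
    and top: "inversions n top_filling \<subseteq> inversions n y"
    and bottom: "inversions n bottom_filling \<subseteq> inversions n y"
    and k: "k1 < k2" "k2 < k3" "k3 < length lam"
  shows "\<not> (lam ! k1 < lam ! k2 \<and> lam ! k3 < lam ! k2)"
    and "\<not> (lam ! k2 < lam ! k1 \<and> lam ! k2 < lam ! k3)"
proof -
  have step: "i \<le> j \<and> i + lam ! l \<le> j + lam ! k"
    if "k < l" "l < length lam" "i < lam ! k" "j < lam ! l" "y (box k i) < y (box l j)" for k l i j
    using subsetD[OF top, of "(box k i, box l j)"] subsetD[OF bottom, of "(box k i, box l j)"] that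
      top_filling_inversion_iff[OF that(1-4)] bottom_filling_inversion_iff[OF that(1-4)]
      inversion_box_iff[OF that(1-4), of y] by linarith
  let ?a = "lam ! k1" and ?b = "lam ! k2" and ?c = "lam ! k3"
  have len: "k1 < length lam" "k2 < length lam" "k3 < length lam" and k13: "k1 < k3"
    using k by auto
  have pos: "0 < ?a" "0 < ?b" "0 < ?c" using part_pos len by auto
  show "\<not> (?a < ?b \<and> ?c < ?b)"
  proof
    assume peak: "?a < ?b \<and> ?c < ?b"
    show False
    proof (cases "?c \<le> ?a")
      case True
      obtain c where c: "box_colouring ?a y c" by (rule Z_set_colouring[OF y])
      have col: "c k3 0 < ?a"
        using box_colouring_all_coloured[OF c len(3) True pos(3)] .
      obtain j where j: "j < ?b" "c k2 j = c k3 0"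
        using box_colouring_all_colours[OF c len(2) _ col] peak by auto
      obtain i where i: "i < ?a" "c k1 i = c k3 0"
        using box_colouring_all_colours[OF c len(1) _ col] by auto
      have "j \<le> 0"
        using step[OF k(2) len(3) j(1) pos(3)] box_colouring_chain[OF c k(2) len(3) j(1) pos(3)] j col by simp
      moreover have "i + ?b \<le> j + ?a"
        using step[OF k(1) len(2) i(1) j(1)] box_colouring_chain[OF c k(1) len(2) i(1) j(1)] i j col by simp
      ultimately show False using peak by simp
    next
      case False
      obtain c where c: "box_colouring ?c y c" by (rule Z_set_colouring[OF y])
      let ?i = "?a - 1"
      have i: "?i < ?a" using pos by simp
      have col: "c k1 ?i < ?c"
        using box_colouring_all_coloured[OF c len(1) _ i] False by simp
      obtain j where j: "j < ?b" "c k2 j = c k1 ?i"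
        using box_colouring_all_colours[OF c len(2) _ col] peak by auto
      obtain l where l: "l < ?c" "c k3 l = c k1 ?i"
        using box_colouring_all_colours[OF c len(3) _ col] by auto
      have "y (box k1 ?i) < y (box k2 j)"
        using box_colouring_chain[OF c k(1) len(2) i j(1)] j col by simp
      then have "?i + ?b \<le> j + ?a"
        using step[OF k(1) len(2) i j(1)] by blast
      moreover have "j \<le> l"
        using step[OF k(2) len(3) j(1) l(1)] box_colouring_chain[OF c k(2) len(3) j(1) l(1)] j l col by simp
      ultimately show False using peak l(1) i by linarith
    qed
  qed
  show "\<not> (?b < ?a \<and> ?b < ?c)"
  proof
    assume valley: "?b < ?a \<and> ?b < ?c"
    let ?m = "min ?a ?c"
    obtain c where c: "box_colouring ?m y c" by (rule Z_set_colouring[OF y])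
    let ?j = "?b - 1"
    have j: "?j < ?b" using pos by simp
    have "card {i. i < ?a \<and> c k1 i < ?m} = ?m"
      using c len(1) unfolding box_colouring_def by simp
    moreover have "{i. i < ?a \<and> c k1 i < ?m} \<subseteq> {..<?b} \<Longrightarrow> card {i. i < ?a \<and> c k1 i < ?m} \<le> ?b"
      using card_mono[of "{..<?b}"] by fastforce
    ultimately obtain i where i: "i < ?a" "c k1 i < ?m" "?b \<le> i"
      using valley by force
    \<comment> \<open>Beyond the last box \<open>?j\<close> of the middle column, only the last box of the third column is left.\<close>
    have last: "l = ?c - 1" if "l < ?c" "y (box k2 ?j) < y (box k3 l)" for l
      using step[OF k(2) len(3) j that] that(1) j by linarith
    have not_less: "\<not> y (box k1 i) < y (box k2 ?j)"
      using step[OF k(1) len(2) i(1) j] i(3) j by linarith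
    obtain l where l: "l < ?c" "c k3 l = c k1 i"
      using box_colouring_all_colours[OF c len(3) _ i(2)] by auto
    have "y (box k1 i) < y (box k3 l)"
      using box_colouring_chain[OF c k13 len(3) i(1) l(1)] l i by simp
    with not_less have "l = ?c - 1" using last[OF l(1)] by linarith
    have col: "c k2 ?j < ?m"
      using box_colouring_all_coloured[OF c len(2) _ j] valley by simp
    obtain l' where l': "l' < ?c" "c k3 l' = c k2 ?j"
      using box_colouring_all_colours[OF c len(3) _ col] by auto
    have "y (box k2 ?j) < y (box k3 l')"
      using box_colouring_chain[OF c k(2) len(3) j l'(1)] l' col by simp
    then have "l' = ?c - 1" using last[OF l'(1)] by simp
    then have "c k1 i = c k2 ?j" using \<open>l = ?c - 1\<close> l l' by simp
    then show False
      using box_colouring_chain[OF c k(1) len(2) i(1) j] i(2) not_less by simp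
  qed
qed

lemma rim_eq_singleton:
  assumes "t \<in> Z_set n lam" "\<And>z. z \<in> Z_set n lam \<Longrightarrow> inversions n z \<subseteq> inversions n t"
  shows "rim n lam = {t}"
proof -
  have perm: "z \<in> Z_set n lam \<Longrightarrow> z permutes {1..n}" for z by (simp add: Z_set_iff)
  have pre: "is_prefix n z t" if "z \<in> Z_set n lam" for z
    using that assms perm is_prefix_iff by blast
  moreover have "z = t" if "z \<in> Z_set n lam" "is_prefix n t z" for z
  proof -
    have "inversions n t \<subseteq> inversions n z"
      using that is_prefix_iff[OF perm[OF assms(1)] perm[OF that(1)]] by blast
    with assms(2)[OF that(1)] show ?thesis
      using inversions_inject[OF perm[OF that(1)] perm[OF assms(1)]] by blast
  qed
  ultimately show ?thesis
    unfolding rim_def using assms(1) by auto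
qed

lemma below_rim_element:
  assumes "z \<in> Z_set n lam"
  shows "\<exists>x\<in>rim n lam. inversions n z \<subseteq> inversions n x"
proof -
  have perm: "z \<in> Z_set n lam \<Longrightarrow> z permutes {1..n}" for z by (simp add: Z_set_iff)
  have "card (inversions n w) < Suc (card ({1..n} \<times> {1..n}))" for w
    unfolding less_Suc_eq_le by (intro card_mono) (auto simp: inversions_def)
  then obtain x where x: "x \<in> Z_set n lam" "inversions n z \<subseteq> inversions n x"
    and max: "\<And>w. w \<in> Z_set n lam \<Longrightarrow> inversions n z \<subseteq> inversions n w \<Longrightarrow>
        card (inversions n w) \<le> card (inversions n x)"
    using ex_has_greatest_nat[of "\<lambda>x. x \<in> Z_set n lam \<and> inversions n z \<subseteq> inversions n x" z
        "\<lambda>x. card (inversions n x)" "Suc (card ({1..n} \<times> {1..n}))"] assms by blast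
  have "w = x" if w: "w \<in> Z_set n lam" "is_prefix n x w" for w
  proof -
    have sub: "inversions n x \<subseteq> inversions n w"
      using w x perm is_prefix_iff by blast
    then have "inversions n x = inversions n w"
      using max[OF w(1)] x(2) by (intro card_seteq) auto
    then show "w = x" using inversions_inject perm w(1) x(1) by metis
  qed
  with x show ?thesis unfolding rim_def by blast
qed

lemma is_partition_iff: "is_partition lam n \<longleftrightarrow> sorted_wrt (\<ge>) lam"
  using comp by (simp add: is_partition_def)

lemma is_partition_rev_iff: "is_partition (rev lam) n \<longleftrightarrow> sorted_wrt (\<le>) lam"
  using comp by (simp add: is_partition_def composition_def sorted_wrt_rev)

theorem card_rim_eq_1_iff: "card (rim n lam) = 1 \<longleftrightarrow> is_partition lam n \<or> is_partition (rev lam) n"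
proof
  assume "is_partition lam n \<or> is_partition (rev lam) n"
  then obtain t where "rim n lam = {t}"
    using rim_eq_singleton[OF top_filling_in_Z Z_set_le_top_filling]
      rim_eq_singleton[OF bottom_filling_in_Z Z_set_le_bottom_filling]
    unfolding is_partition_iff is_partition_rev_iff by blast
  then show "card (rim n lam) = 1" by simp
next
  assume "card (rim n lam) = 1"
  then obtain y where rim: "rim n lam = {y}" by (auto simp: card_1_singleton_iff)
  then have y: "y \<in> Z_set n lam" unfolding rim_def by blast
  have bound: "inversions n z \<subseteq> inversions n y" if "z \<in> Z_set n lam" for z
    using below_rim_element[OF that] rim by simp
  show "is_partition lam n \<or> is_partition (rev lam) n"
  proof (rule ccontr)
    assume "\<not> ?thesis"
    then obtain i j k l where "i < j" "j < length lam" "lam ! i < lam ! j"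
      "k < l" "l < length lam" "lam ! l < lam ! k"
      unfolding is_partition_iff is_partition_rev_iff by (auto simp: sorted_wrt_iff_nth_less not_le)
    then obtain k1 k2 k3 where "k1 < k2" "k2 < k3" "k3 < length lam"
      "lam ! k1 < lam ! k2 \<and> lam ! k3 < lam ! k2 \<or> lam ! k2 < lam ! k1 \<and> lam ! k2 < lam ! k3"
      by (rule peak_or_valley[where a = "\<lambda>k. lam ! k"])
    then show False
      using no_upper_bound[OF y bound[OF top_filling_in_Z] bound[OF bottom_filling_in_Z]] by blast
  qed
qed

end

theorem theorem2p11:
  fixes n :: nat and lam :: "nat list"
  assumes "composition lam n"
  shows "card (rim n lam) = 1 \<longleftrightarrow> is_partition lam n \<or> is_partition (rev lam) n"
  using fixed_composition.card_rim_eq_1_iff[OF fixed_composition.intro[OF assms]] .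

end
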